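(* Let $d\in\{1,2\}$. Then every semi-algebraic set $S\subset\mathbb{R}^d$ belongs to $\mathfrak{A}_d$, the set algebra of subsets of $\mathbb{R}^d$ generated by the semigroups in $\mathbb{R}^d$.
   Context: A semigroup in $\mathbb{R}^d$ is a subset of $\mathbb{R}^d$ which is closed under (vector) addition. $\mathfrak{A}_d$ denotes the set algebra generated by all semigroups in $\mathbb{R}^d$, i.e. the smallest family of subsets of $\mathbb{R}^d$ that contains every semigroup and is closed under complement (in $\mathbb{R}^d$), finite union and finite intersection. Semi-algebraic sets are those defined by finite Boolean combinations of polynomial equations and inequalities with real coefficients. *)

theory Defs
  imports "HOL-Analysis.Analysis"
begin

definition additive_semigroup :: "'a::plus set \<Rightarrow> bool" where
  "additive_semigroup A \<longleftrightarrow> (\<forall>x\<in>A. \<forall>y\<in>A. x + y \<in> A)"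

(* The predicate "algebra UNIV" says that a family contains the empty set and is closed under
   binary unions and under differences; the lemmas below restate this with complements, unions
   and intersections. *)
definition generated_algebra :: "'a set set \<Rightarrow> 'a set set" where
  "generated_algebra G = algebra UNIV hull G"

definition semigroup_algebra :: "'a::plus set set" where
  "semigroup_algebra = generated_algebra {A. additive_semigroup A}"

(* On real^'n every linear functional is a linear combination of the coordinates, so
   real_polynomial_function is exactly the class of functions given by real polynomials in the
   coordinates. *)
definition semialgebraic :: "(real ^ 'n) set \<Rightarrow> bool" where
  "semialgebraic S \<longleftrightarrow> S \<in> generated_algebra
     ({{x. p x = 0} | p. real_polynomial_function p} \<union>
      {{x. p x > 0} | p. real_polynomial_function p} \<union>
      {{x. p x \<ge> 0} | p. real_polynomial_function p})"

lemma algebra_UNIV_iff: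
  "algebra UNIV M \<longleftrightarrow> {} \<in> M \<and> (\<forall>A\<in>M. - A \<in> M) \<and>
     (\<forall>A\<in>M. \<forall>B\<in>M. A \<union> B \<in> M) \<and> (\<forall>A\<in>M. \<forall>B\<in>M. A \<inter> B \<in> M)"
proof -
  have "A \<inter> B = - (- A \<union> - B)" for A B :: "'a set"
    by blast
  then have "(\<forall>A\<in>M. - A \<in> M) \<Longrightarrow> (\<forall>A\<in>M. \<forall>B\<in>M. A \<union> B \<in> M) \<Longrightarrow>
      (\<forall>A\<in>M. \<forall>B\<in>M. A \<inter> B \<in> M)"
    by metis
  then show ?thesis
    unfolding algebra_iff_Un Compl_eq_Diff_UNIV[symmetric] by blast
qed

lemma algebra_generated_algebra: "algebra UNIV (generated_algebra G)"
  unfolding generated_algebra_def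
  by (rule hull_in) (auto simp: algebra_UNIV_iff)

lemma generated_algebra_base: "A \<in> G \<Longrightarrow> A \<in> generated_algebra G"
  unfolding generated_algebra_def by (rule hull_inc)

lemma generated_algebra_minimal:
  "G \<subseteq> M \<Longrightarrow> algebra UNIV M \<Longrightarrow> generated_algebra G \<subseteq> M"
  unfolding generated_algebra_def by (rule hull_minimal)

end

theory Submission
  imports Defs
begin

text \<open>Write a point of the half-plane \<open>x > 0\<close> as \<open>(x, x * m)\<close>. An arbitrary subset of a strip
  \<open>c \<le> x < 2 * c\<close> becomes a semigroup when \<open>{x \<ge> 2 * c}\<close> is added to it, so only the behaviour
  for \<open>x\<close> near \<open>0\<close> and near infinity matters. There the real roots in \<open>m\<close> of a polynomial
  \<open>q(x, m)\<close> are finitely many disjoint continuous functions \<open>g\<close> of \<open>x\<close>, eventually monotone by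
  implicit differentiation; and for monotone \<open>g\<close> the set of points with slope \<open>m\<close> below \<open>g x\<close>
  or its complement is a semigroup. The existence of the root functions and the
  fact that a polynomial \<open>Q(x, g x)\<close> is eventually of constant sign are proved by a simultaneous
  induction on the degree, through the derivative in \<open>m\<close> and through pseudo-division.\<close>

section \<open>Set algebras\<close>

lemma semigroup_algebra_closed:
  shows semigroup_algebra_base: "additive_semigroup A \<Longrightarrow> A \<in> semigroup_algebra"
    and semigroup_algebra_Compl: "A \<in> semigroup_algebra \<Longrightarrow> - A \<in> semigroup_algebra"
    and semigroup_algebra_Un:
      "A \<in> semigroup_algebra \<Longrightarrow> B \<in> semigroup_algebra \<Longrightarrow> A \<union> B \<in> semigroup_algebra"
    and semigroup_algebra_Int:
      "A \<in> semigroup_algebra \<Longrightarrow> B \<in> semigroup_algebra \<Longrightarrow> A \<inter> B \<in> semigroup_algebra"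
    and semigroup_algebra_empty: "{} \<in> semigroup_algebra"
  using algebra_generated_algebra[of "{A. additive_semigroup A}"]
  unfolding semigroup_algebra_def algebra_UNIV_iff
  by (auto intro: generated_algebra_base)

lemma semigroup_algebra_Diff:
  "A \<in> semigroup_algebra \<Longrightarrow> B \<in> semigroup_algebra \<Longrightarrow> A - B \<in> semigroup_algebra"
  unfolding Diff_eq by (intro semigroup_algebra_Int semigroup_algebra_Compl)

text \<open>Such an \<open>S\<close> is a union of atoms of the finite Boolean algebra generated by
  \<open>F\<close>. Induction on \<open>F\<close> splits the atoms along one further set.\<close>

lemma algebra_determined_by_finite:
  assumes M: "algebra UNIV M" and "finite F" "F \<subseteq> M"
    and "\<And>x y. (\<And>A. A \<in> F \<Longrightarrow> x \<in> A \<longleftrightarrow> y \<in> A) \<Longrightarrow> x \<in> S \<Longrightarrow> y \<in> S"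
  shows "S \<in> M"
  using assms(2-)
proof (induction F arbitrary: S rule: finite_induct)
  case empty
  have "S = {} \<or> S = - {}"
    using empty.prems(2) by blast
  then show ?case
    using M unfolding algebra_UNIV_iff by metis
next
  case (insert A F)
  \<comment> \<open>\<open>U B\<close> saturates \<open>S \<inter> B\<close> under agreement on
    \<open>F\<close> alone, so the induction hypothesis applies to it; cutting back to
    \<open>B\<close> recovers \<open>S \<inter> B\<close> for \<open>B = A\<close> and
    \<open>B = - A\<close>.\<close>
  define U where "U B = {x. \<exists>y\<in>S \<inter> B. \<forall>C\<in>F. x \<in> C \<longleftrightarrow> y \<in> C}" for B
  have "U B \<in> M" for B
    by (rule insert.IH) (use insert.prems in \<open>auto simp: U_def\<close>)
  moreover have "S = U A \<inter> A \<union> U (- A) \<inter> - A"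
  proof (intro set_eqI iffI)
    fix x assume "x \<in> S"
    then show "x \<in> U A \<inter> A \<union> U (- A) \<inter> - A"
      unfolding U_def by blast
  next
    fix x assume "x \<in> U A \<inter> A \<union> U (- A) \<inter> - A"
    then obtain y where "y \<in> S" "y \<in> A \<longleftrightarrow> x \<in> A" "\<forall>C\<in>F. x \<in> C \<longleftrightarrow> y \<in> C"
      unfolding U_def by blast
    then show "x \<in> S"
      using insert.prems(2)[of y x] by auto
  qed
  ultimately show ?case
    using M insert.prems(1) unfolding algebra_UNIV_iff by (metis insert_subset)
qed

lemma semigroup_algebra_determined:
  fixes S :: "'a::plus set"
  assumes "finite F" "F \<subseteq> semigroup_algebra"
    and "\<And>x y. (\<And>A. A \<in> F \<Longrightarrow> x \<in> A \<longleftrightarrow> y \<in> A) \<Longrightarrow> x \<in> S \<Longrightarrow> y \<in> S"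
  shows "S \<in> semigroup_algebra"
proof (rule algebra_determined_by_finite)
  show "algebra UNIV (semigroup_algebra :: 'a set set)"
    unfolding semigroup_algebra_def by (rule algebra_generated_algebra)
qed (fact assms)+

text \<open>Negation is an additive automorphism, so the sets with preimage in the algebra form an
  algebra containing all semigroups. This carries results from one side of the hyperplane
  \<open>v $ i = 0\<close> to the other.\<close>

lemma semigroup_algebra_vimage_uminus:
  fixes S :: "'a::ab_group_add set"
  assumes "S \<in> semigroup_algebra"
  shows "uminus -` S \<in> semigroup_algebra"
proof -
  have "generated_algebra {A. additive_semigroup A} \<subseteq> {A. uminus -` A \<in> (semigroup_algebra :: 'a set set)}"
  proof (rule generated_algebra_minimal)
    show "{A. additive_semigroup A} \<subseteq> {A. uminus -` A \<in> (semigroup_algebra :: 'a set set)}"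
      by (auto intro!: semigroup_algebra_base simp: additive_semigroup_def) (metis minus_add_distrib uminus_add_conv_diff)
    show "algebra UNIV {A. uminus -` A \<in> (semigroup_algebra :: 'a set set)}"
      unfolding algebra_UNIV_iff
      by (auto simp: vimage_Compl semigroup_algebra_empty
          intro: semigroup_algebra_Compl semigroup_algebra_Un semigroup_algebra_Int)
  qed
  then show ?thesis
    using assms unfolding semigroup_algebra_def by auto
qed

section \<open>Semigroups defined by coordinates\<close>

text \<open>For \<open>c \<ge> 0\<close> a sum of coordinates above \<open>c\<close> stays above
  \<open>c\<close>; for \<open>c < 0\<close> it is the complement that is closed under
  addition.\<close>

lemma semigroup_algebra_coord_greater:
  "{v :: real ^ 'n. c < v $ i} \<in> semigroup_algebra"
proof (cases "c \<ge> 0")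
  case True
  then show ?thesis
    by (intro semigroup_algebra_base) (auto simp: additive_semigroup_def)
next
  case False
  have "{v :: real ^ 'n. c < v $ i} = - {v. v $ i \<le> c}"
    by auto
  also have "\<dots> \<in> semigroup_algebra"
    using False
    by (intro semigroup_algebra_Compl semigroup_algebra_base) (auto simp: additive_semigroup_def)
  finally show ?thesis .
qed

lemma semigroup_algebra_coord_less:
  "{v :: real ^ 'n. v $ i < c} \<in> semigroup_algebra"
proof -
  have "{v :: real ^ 'n. v $ i < c} = uminus -` {v. - c < v $ i}"
    by auto
  then show ?thesis
    by (metis semigroup_algebra_vimage_uminus semigroup_algebra_coord_greater)
qed

lemma semigroup_algebra_strip:
  fixes T :: "(real ^ 'n) set"
  assumes "c > 0" "T \<subseteq> {v. c \<le> v $ i \<and> v $ i < 2 * c}"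
  shows "T \<in> semigroup_algebra"
proof -
  have "additive_semigroup (T \<union> {v. 2 * c \<le> v $ i})"
    unfolding additive_semigroup_def
  proof (intro ballI)
    fix x y assume "x \<in> T \<union> {v. 2 * c \<le> v $ i}" "y \<in> T \<union> {v. 2 * c \<le> v $ i}"
    then have "c \<le> x $ i" "c \<le> y $ i"
      using assms by auto
    then show "x + y \<in> T \<union> {v. 2 * c \<le> v $ i}"
      by simp
  qed
  moreover have "T = (T \<union> {v. 2 * c \<le> v $ i}) \<inter> {v. v $ i < 2 * c}"
    using assms by auto
  ultimately show ?thesis
    by (metis semigroup_algebra_base semigroup_algebra_Int semigroup_algebra_coord_less)
qed

text \<open>Finitely many dyadic strips from \<open>2 ^ k * a\<close> to
  \<open>2 * 2 ^ k * a\<close> cover the bounded strip, and inside each of them every subset is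
  available.\<close>

lemma semigroup_algebra_bounded_strip:
  fixes T :: "(real ^ 'n) set"
  assumes "a > 0" "T \<subseteq> {v. a \<le> v $ i \<and> v $ i \<le> b}"
  shows "T \<in> semigroup_algebra"
proof -
  have *: "T \<in> semigroup_algebra" if "T \<subseteq> {v. a \<le> v $ i \<and> v $ i < 2 ^ k * a}"
    for k and T :: "(real ^ 'n) set"
    using that
  proof (induction k arbitrary: T)
    case 0
    then have "T = {}"
      by fastforce
    then show ?case
      by (simp add: semigroup_algebra_empty)
  next
    case (Suc k)
    have "T \<inter> {v. v $ i < 2 ^ k * a} \<in> semigroup_algebra"
      using Suc.prems by (intro Suc.IH) auto
    moreover have "T \<inter> {v. 2 ^ k * a \<le> v $ i} \<in> semigroup_algebra"
      using Suc.prems \<open>a > 0\<close> by (intro semigroup_algebra_strip[of "2 ^ k * a" _ i]) auto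
    moreover have "T = T \<inter> {v. v $ i < 2 ^ k * a} \<union> T \<inter> {v. 2 ^ k * a \<le> v $ i}"
      by auto
    ultimately show ?case
      by (metis semigroup_algebra_Un)
  qed
  obtain k where "b / a < 2 ^ k"
    using real_arch_pow[of 2 "b / a"] by auto
  then have "b < 2 ^ k * a"
    using \<open>a > 0\<close> by (simp add: field_simps)
  then show ?thesis
    using assms(2) by (intro *[of T k]) auto
qed

section \<open>Conditions over an interval of positive abscissas\<close>

lemma interval_trichotomy:
  fixes I :: "real set"
  assumes "is_interval I" "x \<in> I" "x \<le> z"
  shows "z \<in> I \<or> (\<forall>w\<in>I. w < z)"
  using assms unfolding is_interval_1 by (meson not_less)

text \<open>These points form the absorbing set that completes a condition additive only over
  \<open>I\<close> to a semigroup. All coordinates in play are positive, so a sum lies even further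
  beyond \<open>I\<close>.\<close>

lemma semigroup_algebra_above:
  fixes I :: "real set"
  assumes "I \<subseteq> {0<..}" "is_interval I" "I \<noteq> {}"
  shows "{v :: real ^ 'n. \<forall>x\<in>I. x < v $ i} \<in> semigroup_algebra"
proof (rule semigroup_algebra_base, unfold additive_semigroup_def, intro ballI, clarify)
  fix v w :: "real ^ 'n" and x
  assume "\<forall>x\<in>I. x < v $ i" "\<forall>x\<in>I. x < w $ i" "x \<in> I"
  then have "x < v $ i" "x < w $ i" "0 < x"
    using assms by auto
  then show "x < (v + w) $ i"
    by simp
qed

text \<open>A sum of two points over \<open>I\<close> either stays over \<open>I\<close>, where
  \<open>Q\<close> is additive, or passes beyond \<open>I\<close> into \<open>B\<close>, which
  absorbs everything. So \<open>A \<union> B\<close> is a semigroup, and removing \<open>B\<close>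
  leaves \<open>A\<close>.\<close>

lemma semigroup_algebra_slab:
  fixes I :: "real set" and Q :: "real \<Rightarrow> real \<Rightarrow> bool"
  assumes I: "I \<subseteq> {0<..}" "is_interval I" "I \<noteq> {}"
    and Q: "\<And>x y x' y'. \<lbrakk>x \<in> I; x' \<in> I; x + x' \<in> I; Q x y; Q x' y'\<rbrakk> \<Longrightarrow> Q (x + x') (y + y')"
  shows "{v :: real ^ 'n. v $ i \<in> I \<and> Q (v $ i) (v $ j)} \<in> semigroup_algebra"
proof -
  define A B where "A = {v :: real ^ 'n. v $ i \<in> I \<and> Q (v $ i) (v $ j)}"
    and "B = {v :: real ^ 'n. \<forall>x\<in>I. x < v $ i}"
  have B: "B \<in> semigroup_algebra"
    unfolding B_def by (rule semigroup_algebra_above[OF I])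
  have pos: "0 < v $ i" if "v \<in> A \<union> B" for v
    using that I unfolding A_def B_def by fastforce
  have add_B: "v + w \<in> B" if "v \<in> B" "w \<in> A \<union> B" for v w
    using that(1) pos[OF that(2)] unfolding B_def by fastforce
  have "v + w \<in> A \<union> B" if "v \<in> A" "w \<in> A" for v w
  proof -
    have "v $ i \<in> I" "v $ i \<le> (v + w) $ i"
      using that pos[of w] by (auto simp: A_def)
    then have "(v + w) $ i \<in> I \<or> v + w \<in> B"
      using interval_trichotomy[OF I(2), of "v $ i" "(v + w) $ i"] by (auto simp: B_def)
    then show ?thesis
      using that Q[of "v $ i" "w $ i" "v $ j" "w $ j"] by (auto simp: A_def)
  qed
  with add_B have "additive_semigroup (A \<union> B)"
    unfolding additive_semigroup_def by (metis Un_iff add.commute)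
  moreover have "A \<inter> B = {}"
    unfolding A_def B_def by fastforce
  then have "A = (A \<union> B) - B"
    by blast
  ultimately show ?thesis
    unfolding A_def[symmetric] using B by (metis semigroup_algebra_base semigroup_algebra_Diff)
qed

lemma semigroup_algebra_interval:
  fixes I :: "real set"
  assumes "I \<subseteq> {0<..}" "is_interval I" "I \<noteq> {}"
  shows "{v :: real ^ 'n. v $ i \<in> I} \<in> semigroup_algebra"
  using semigroup_algebra_slab[OF assms, of "\<lambda>_ _. True" i i] by simp

text \<open>Slopes of sums are weighted means of slopes, so for increasing \<open>g\<close> the points of slope
  below \<open>g\<close> form a semigroup, and for decreasing \<open>g\<close> their complement does.\<close>
lemma semigroup_algebra_below_monotone_slope:
  fixes I :: "real set" and g :: "real \<Rightarrow> real"
  assumes I: "I \<subseteq> {0<..}" "is_interval I" "I \<noteq> {}"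
    and g: "mono_on I g \<or> antimono_on I g"
  shows "{v :: real ^ 'n. v $ i \<in> I \<and> v $ j < v $ i * g (v $ i)} \<in> semigroup_algebra" (is "?L \<in> _")
    and "{v :: real ^ 'n. v $ i \<in> I \<and> v $ j > v $ i * g (v $ i)} \<in> semigroup_algebra" (is "?G \<in> _")
proof -
  let ?I = "{v :: real ^ 'n. v $ i \<in> I}"
  let ?L' = "{v :: real ^ 'n. v $ i \<in> I \<and> v $ j \<le> v $ i * g (v $ i)}"
  let ?G' = "{v :: real ^ 'n. v $ i \<in> I \<and> v $ j \<ge> v $ i * g (v $ i)}"
  have inI: "?I \<in> semigroup_algebra"
    by (rule semigroup_algebra_interval[OF I])
  have eq: "?L = ?I - ?G'" "?G = ?I - ?L'"
    by auto
  \<comment> \<open>One side of the graph, both with and without the graph itself, satisfies the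
    additivity condition of \<open>semigroup_algebra_slab\<close>: the lower side for increasing
    \<open>g\<close>, the upper side for decreasing \<open>g\<close>. The other side is a complement
    over \<open>I\<close>.\<close>
  have "(?L \<in> semigroup_algebra \<and> ?L' \<in> semigroup_algebra) \<or>
      (?G \<in> semigroup_algebra \<and> ?G' \<in> semigroup_algebra)"
    using g
  proof
    assume m: "mono_on I g"
    have "x * g x + x' * g x' \<le> (x + x') * g (x + x')" if "x \<in> I" "x' \<in> I" "x + x' \<in> I" for x x'
    proof -
      have "0 < x" "0 < x'"
        using that I by auto
      then have "g x \<le> g (x + x')" "g x' \<le> g (x + x')"
        using that monotone_onD[OF m, of x "x + x'"] monotone_onD[OF m, of x' "x + x'"] by auto
      with \<open>0 < x\<close> \<open>0 < x'\<close> show ?thesis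
        unfolding distrib_right by (intro add_mono mult_left_mono) auto
    qed
    then show ?thesis
      by (intro disjI1 conjI semigroup_algebra_slab[OF I]) fastforce+
  next
    assume m: "antimono_on I g"
    have "x * g x + x' * g x' \<ge> (x + x') * g (x + x')" if "x \<in> I" "x' \<in> I" "x + x' \<in> I" for x x'
    proof -
      have "0 < x" "0 < x'"
        using that I by auto
      then have "g x \<ge> g (x + x')" "g x' \<ge> g (x + x')"
        using that monotone_onD[OF m, of x "x + x'"] monotone_onD[OF m, of x' "x + x'"] by auto
      with \<open>0 < x\<close> \<open>0 < x'\<close> show ?thesis
        unfolding distrib_right by (intro add_mono mult_left_mono) auto
    qed
    then show ?thesis
      by (intro disjI2 conjI semigroup_algebra_slab[OF I]) fastforce+
  qed
  then show "?L \<in> semigroup_algebra" "?G \<in> semigroup_algebra"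
    using semigroup_algebra_Diff[OF inI, of ?G'] semigroup_algebra_Diff[OF inI, of ?L']
    unfolding eq[symmetric] by blast+
qed

section \<open>Constancy of signs on intervals and one-variable sign conditions\<close>

lemma sgn_eq_if_no_zero_between:
  fixes f :: "real \<Rightarrow> real"
  assumes I: "is_interval I" and "continuous_on I f" "\<And>x. x \<in> I \<Longrightarrow> f x \<noteq> 0" "a \<in> I" "b \<in> I"
  shows "sgn (f a) = sgn (f b)"
proof (rule ccontr)
  assume ne: "sgn (f a) \<noteq> sgn (f b)"
  have "f a \<noteq> 0" "f b \<noteq> 0"
    using assms by auto
  then have "(f a < 0 \<and> 0 < f b) \<or> (f b < 0 \<and> 0 < f a)"
    using ne by (auto simp: sgn_if split: if_splits)
  moreover have "is_interval (f ` I)"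
    using assms(2) I by (metis connected_continuous_image is_interval_connected_1)
  ultimately have "0 \<in> f ` I"
    using assms(4,5) unfolding is_interval_1 by (meson imageI less_imp_le)
  then show False
    using assms(3) by auto
qed

text \<open>The roots of \<open>r\<close> cut the line into finitely many cells of constant sign,
  and half-spaces at the roots decide the cell. This will settle the points with
  \<open>v $ i = 0\<close>, which have no slope. The arbitrary predicate \<open>R\<close> treats
  equations and inequalities at once.\<close>

lemma semigroup_algebra_univariate:
  fixes r :: "real poly"
  shows "{v :: real ^ 'n. R (sgn (poly r (v $ j)))} \<in> semigroup_algebra"
proof (cases "r = 0")
  case True
  then show ?thesis
    using semigroup_algebra_Compl[OF semigroup_algebra_empty] semigroup_algebra_empty
    by (cases "R 0") auto
next
  case False
  define Z where "Z = {z. poly r z = 0}"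
  have "finite Z"
    unfolding Z_def by (rule poly_roots_finite[OF False])
  let ?F = "(\<lambda>z. {v :: real ^ 'n. v $ j < z}) ` Z \<union> (\<lambda>z. {v. z < v $ j}) ` Z"
  show ?thesis
  proof (rule semigroup_algebra_determined[of ?F])
    show "finite ?F"
      using \<open>finite Z\<close> by simp
    show "?F \<subseteq> semigroup_algebra"
      by (auto intro: semigroup_algebra_coord_less semigroup_algebra_coord_greater)
    fix v w :: "real ^ 'n"
    assume vw: "\<And>A. A \<in> ?F \<Longrightarrow> v \<in> A \<longleftrightarrow> w \<in> A"
    have less: "v $ j < z \<longleftrightarrow> w $ j < z" and greater: "z < v $ j \<longleftrightarrow> z < w $ j" if "z \<in> Z" for z
      using vw[of "{v. v $ j < z}"] vw[of "{v. z < v $ j}"] that by auto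
    have "sgn (poly r (v $ j)) = sgn (poly r (w $ j))"
    proof (cases "v $ j \<in> Z \<or> w $ j \<in> Z")
      case True
      then have "v $ j = w $ j"
        using less greater by (metis less_irrefl linorder_neqE)
      then show ?thesis
        by simp
    next
      case False
      let ?I = "{min (v $ j) (w $ j)..max (v $ j) (w $ j)}"
      have "poly r z \<noteq> 0" if "z \<in> ?I" for z
      proof
        assume "poly r z = 0"
        then have "z \<in> Z"
          by (simp add: Z_def)
        with less[of z] greater[of z] False that show False
          by (cases "v $ j = z"; cases "w $ j = z") (auto simp: min_def max_def split: if_splits)
      qed
      then show ?thesis
        by (intro sgn_eq_if_no_zero_between[of ?I]) (auto intro!: continuous_intros simp: is_interval_cc)
    qed
    then show "v \<in> {v. R (sgn (poly r (v $ j)))} \<Longrightarrow> w \<in> {v. R (sgn (poly r (v $ j)))}"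
      by simp
  qed
qed

section \<open>Bivariate polynomials\<close>

text \<open>\<open>P\<close> is a polynomial in \<open>m\<close> with coefficients in
  \<open>real[x]\<close>, so its degree, leading coefficient, \<open>pderiv\<close> and
  pseudo-division all refer to \<open>m\<close>.\<close>

definition bieval :: "real poly poly \<Rightarrow> real \<Rightarrow> real \<Rightarrow> real" where
  "bieval P x m = poly (poly P [:m:]) x"

lemma bieval_simps [simp]:
  "bieval 0 x m = 0"
  "bieval (pCons a P) x m = poly a x + m * bieval P x m"
  "bieval (P + Q) x m = bieval P x m + bieval Q x m"
  "bieval (P * Q) x m = bieval P x m * bieval Q x m"
  "bieval (smult c P) x m = poly c x * bieval P x m"
  by (simp_all add: bieval_def)

lemma poly_poly_eq_bieval: "poly (poly P c) x = bieval P x (poly c x)"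
  by (induction P) (simp_all add: bieval_def)

lemma continuous_on_bieval [continuous_intros]:
  fixes f g :: "'a::topological_space \<Rightarrow> real"
  assumes "continuous_on S f" "continuous_on S g"
  shows "continuous_on S (\<lambda>x. bieval P (f x) (g x))"
proof (induction P)
  case 0
  then show ?case by simp
next
  case (pCons a P)
  have "continuous_on S (\<lambda>x. poly a (f x))"
    using continuous_on_compose2[OF continuous_on_poly[OF continuous_on_id] assms(1), of UNIV a]
    by simp
  then show ?case
    using pCons assms by (auto intro!: continuous_intros)
qed

lemma DERIV_bieval: "((\<lambda>m. bieval P x m) has_real_derivative bieval (pderiv P) x m) (at m)"
proof (induction P)
  case 0
  then show ?case by simp
next
  case (pCons a P)
  then show ?case
    by (auto intro!: derivative_eq_intros simp: pderiv_pCons)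
qed

text \<open>A Cauchy-type root bound, built along Horner's scheme so that it is continuous in
  \<open>x\<close>. Continuity lets \<open>b\<close> and \<open>- b\<close> act as two further
  graphs enclosing all root graphs.\<close>

lemma bieval_root_bound:
  obtains b where "continuous_on {x. poly (lead_coeff P) x \<noteq> 0} b" "\<And>x. 0 < b x"
    and "\<And>x m. \<lbrakk>poly (lead_coeff P) x \<noteq> 0; b x \<le> \<bar>m\<bar>\<rbrakk> \<Longrightarrow> bieval P x m \<noteq> 0"
proof -
  \<comment> \<open>The induction needs a quantitative form: beyond \<open>b\<close> the value is at
    least the leading coefficient in absolute value, which is trivial where that coefficient
    vanishes.\<close>
  have "\<exists>b. continuous_on {x. poly (lead_coeff P) x \<noteq> 0} b \<and> (\<forall>x. 0 < b x) \<and>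
    (\<forall>x m. b x \<le> \<bar>m\<bar> \<longrightarrow> \<bar>poly (lead_coeff P) x\<bar> \<le> \<bar>bieval P x m\<bar>)"
  proof (induction P)
    case 0
    then show ?case
      by (auto intro!: exI[of _ "\<lambda>_. 1"])
  next
    case (pCons a P)
    show ?case
    proof (cases "P = 0")
      case True
      then show ?thesis
        by (auto intro!: exI[of _ "\<lambda>_. 1"])
    next
      case False
      let ?c = "poly (lead_coeff P)"
      from pCons obtain b where b: "continuous_on {x. ?c x \<noteq> 0} b" "\<And>x. 0 < b x"
        "\<And>x m. b x \<le> \<bar>m\<bar> \<Longrightarrow> \<bar>?c x\<bar> \<le> \<bar>bieval P x m\<bar>"
        by blast
      \<comment> \<open>The second term is chosen so that multiplying the inductive lower bound by
        \<open>m\<close> leaves a surplus of the leading coefficient over the new constant term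
        \<open>a\<close>.\<close>
      let ?b = "\<lambda>x. max (b x) (\<bar>poly a x\<bar> / \<bar>?c x\<bar> + 1)"
      have "continuous_on {x. ?c x \<noteq> 0} ?b"
        using b(1) by (auto intro!: continuous_intros)
      moreover have "0 < ?b x" for x
        using b(2)[of x] by (simp add: less_max_iff_disj)
      moreover have "\<bar>?c x\<bar> \<le> \<bar>poly a x + m * bieval P x m\<bar>" if "?b x \<le> \<bar>m\<bar>" for x m
      proof (cases "?c x = 0")
        case False
        have "\<bar>poly a x\<bar> + \<bar>?c x\<bar> = (\<bar>poly a x\<bar> / \<bar>?c x\<bar> + 1) * \<bar>?c x\<bar>"
          using False by (simp add: field_simps)
        also have "\<dots> \<le> \<bar>m\<bar> * \<bar>bieval P x m\<bar>"
          using that b(3)[of x m] by (intro mult_mono) auto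
        finally show ?thesis
          by (simp add: abs_mult[symmetric])
      qed simp
      ultimately show ?thesis
        using False by (intro exI[of _ ?b]) simp
    qed
  qed
  then show ?thesis
    using that by fastforce
qed

section \<open>Families of disjoint graphs\<close>

definition disjoint_graphs :: "real set \<Rightarrow> (real \<Rightarrow> real) set \<Rightarrow> bool" where
  "disjoint_graphs I F \<longleftrightarrow> finite F \<and> (\<forall>f\<in>F. continuous_on I f) \<and>
     (\<forall>f\<in>F. \<forall>g\<in>F. \<forall>x\<in>I. f x = g x \<longrightarrow> f = g)"

definition adjacent_graphs :: "real set \<Rightarrow> (real \<Rightarrow> real) set \<Rightarrow> (real \<Rightarrow> real) \<Rightarrow> (real \<Rightarrow> real) \<Rightarrow> bool" where
  "adjacent_graphs I F s t \<longleftrightarrow> s \<in> F \<and> t \<in> F \<and>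
     (\<forall>x\<in>I. s x < t x \<and> (\<forall>u\<in>F. u x \<le> s x \<or> t x \<le> u x))"

text \<open>The condition on the leading coefficient keeps the degree in \<open>m\<close> fixed over
  \<open>I\<close>, so no root escapes to infinity and \<open>bieval_root_bound\<close> applies
  throughout \<open>I\<close>.\<close>

definition root_family :: "real poly poly \<Rightarrow> real set \<Rightarrow> (real \<Rightarrow> real) set \<Rightarrow> bool" where
  "root_family P I G \<longleftrightarrow> disjoint_graphs I G \<and> (\<forall>x\<in>I. poly (lead_coeff P) x \<noteq> 0) \<and>
     (\<forall>x\<in>I. \<forall>m. bieval P x m = 0 \<longleftrightarrow> (\<exists>g\<in>G. g x = m))"

definition const_sign :: "(real \<Rightarrow> real) \<Rightarrow> real set \<Rightarrow> bool" where
  "const_sign f I \<longleftrightarrow> (\<exists>c. \<forall>x\<in>I. sgn (f x) = c)"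

lemma const_sign_subset: "const_sign f I \<Longrightarrow> I' \<subseteq> I \<Longrightarrow> const_sign f I'"
  unfolding const_sign_def by blast

lemma const_sign_eq: "const_sign f I \<Longrightarrow> x \<in> I \<Longrightarrow> y \<in> I \<Longrightarrow> sgn (f x) = sgn (f y)"
  unfolding const_sign_def by metis

lemma root_family_zero_iff:
  "root_family P I G \<Longrightarrow> x \<in> I \<Longrightarrow> bieval P x m = 0 \<longleftrightarrow> (\<exists>g\<in>G. g x = m)"
  unfolding root_family_def by blast

lemma root_family_subset: "root_family P I G \<Longrightarrow> I' \<subseteq> I \<Longrightarrow> root_family P I' G"
  unfolding root_family_def disjoint_graphs_def
  by (meson continuous_on_subset in_mono)

lemma const_sign_if_nonzero:
  assumes "is_interval I" "continuous_on I f" "\<And>x. x \<in> I \<Longrightarrow> f x \<noteq> 0"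
  shows "const_sign f I"
proof (cases "I = {}")
  case False
  then obtain a where "a \<in> I"
    by blast
  then have "\<forall>x\<in>I. sgn (f x) = sgn (f a)"
    using sgn_eq_if_no_zero_between[OF assms] by blast
  then show ?thesis
    unfolding const_sign_def by blast
qed (simp add: const_sign_def)

lemma disjoint_graphs_order:
  assumes "is_interval I" "disjoint_graphs I F" "f \<in> F" "g \<in> F" "x \<in> I" "f x < g x" "y \<in> I"
  shows "f y < g y"
proof -
  have "g z - f z \<noteq> 0" if "z \<in> I" for z
    using assms that unfolding disjoint_graphs_def by (metis eq_iff_diff_eq_0 less_irrefl)
  moreover have "continuous_on I (\<lambda>z. g z - f z)"
    using assms unfolding disjoint_graphs_def by (auto intro!: continuous_intros)
  ultimately have "sgn (g y - f y) = sgn (g x - f x)"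
    using assms by (intro sgn_eq_if_no_zero_between[of I "\<lambda>z. g z - f z"]) auto
  with \<open>f x < g x\<close> show ?thesis
    by (simp add: sgn_if split: if_splits)
qed

text \<open>The points where \<open>f\<close> agrees with one fixed member and those where it agrees
  with another are closed in \<open>I\<close>, disjoint, and cover \<open>I\<close>; connectedness
  leaves only one of the two sets.\<close>

lemma disjoint_graphs_select:
  assumes I: "is_interval I" "I \<noteq> {}" and F: "disjoint_graphs I F"
    and f: "continuous_on I f" "\<And>x. x \<in> I \<Longrightarrow> \<exists>g\<in>F. f x = g x"
  shows "\<exists>g\<in>F. \<forall>x\<in>I. f x = g x"
proof -
  obtain x g where x: "x \<in> I" "g \<in> F" "f x = g x"
    using I(2) f(2) by blast
  define E where "E h = {x \<in> I. f x - h x = 0}" for h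
  have E: "closedin (top_of_set I) (E h)" if "h \<in> F" for h
    unfolding E_def using f(1) F that
    by (intro continuous_closedin_preimage_constant continuous_intros) (auto simp: disjoint_graphs_def)
  define E' where "E' = \<Union> (E ` (F - {g}))"
  have "closedin (top_of_set I) E'"
    unfolding E'_def using F E by (intro closedin_Union) (auto simp: disjoint_graphs_def)
  moreover have "I \<subseteq> E g \<union> E'"
    using f(2) unfolding E_def E'_def by fastforce
  moreover have "E g \<inter> E' = {}"
    using F x(2) unfolding E_def E'_def disjoint_graphs_def by fastforce
  moreover have "x \<in> E g"
    using x by (simp add: E_def)
  moreover have "connected I"
    using I by (simp add: is_interval_connected)
  ultimately have "E' = {}"
    using E[OF x(2)] unfolding connected_closedin by blast
  with \<open>I \<subseteq> E g \<union> E'\<close> have "\<forall>x\<in>I. f x = g x"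
    by (auto simp: E_def)
  with x(2) show ?thesis
    by blast
qed

text \<open>Take the nearest graphs below and above \<open>m\<close> at the single point
  \<open>x\<close>. Disjoint graphs keep their order over an interval, so these two are neighbours
  over all of \<open>I\<close>.\<close>

lemma adjacent_graphs_exist:
  assumes I: "is_interval I" and F: "disjoint_graphs I F"
    and x: "x \<in> I" and lower: "a \<in> F" "a x < m" and upper: "b \<in> F" "m < b x"
    and "\<And>f. f \<in> F \<Longrightarrow> f x \<noteq> m"
  obtains s t where "adjacent_graphs I F s t" "s x < m" "m < t x"
proof -
  let ?L = "(\<lambda>f. f x) ` {f \<in> F. f x < m}" and ?U = "(\<lambda>f. f x) ` {f \<in> F. m < f x}"
  have fin: "finite ?L" "finite ?U" and ne: "?L \<noteq> {}" "?U \<noteq> {}"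
    using F lower upper by (auto simp: disjoint_graphs_def)
  have "Max ?L \<in> ?L" "Min ?U \<in> ?U"
    by (rule Max_in[OF fin(1) ne(1)], rule Min_in[OF fin(2) ne(2)])
  then obtain s t where s: "s \<in> F" "s x < m" "s x = Max ?L" and t: "t \<in> F" "m < t x" "t x = Min ?U"
    by auto
  have between: "u x \<le> s x \<or> t x \<le> u x" if "u \<in> F" for u
  proof -
    have "u x < m \<or> m < u x"
      using assms(8)[OF that] by linarith
    then have "u x \<in> ?L \<or> u x \<in> ?U"
      using that by blast
    then show ?thesis
      using Max_ge[OF fin(1)] Min_le[OF fin(2)] s(3) t(3) by auto
  qed
  have order: "f y < g y" if "f \<in> F" "g \<in> F" "f x < g x" "y \<in> I" for f g y
    using disjoint_graphs_order[OF I F that(1,2) x that(3,4)] .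
  have "u y \<le> s y \<or> t y \<le> u y" if "u \<in> F" "y \<in> I" for u y
  proof -
    have "u = s \<or> u x < s x \<or> t x < u x \<or> u = t"
      using between[OF that(1)] F that(1) s(1) t(1) x unfolding disjoint_graphs_def by (metis less_eq_real_def)
    then show ?thesis
      using order that s(1) t(1) by (metis less_imp_le order_refl)
  qed
  then have "adjacent_graphs I F s t"
    unfolding adjacent_graphs_def using order s t by auto
  with s t that show ?thesis
    by blast
qed

section \<open>Continuity of an isolated zero in its parameter\<close>

lemma exists_zero_between:
  fixes f :: "real \<Rightarrow> real"
  assumes "continuous_on {a..b} f" "f a * f b < 0" "a < b"
  shows "\<exists>m. a < m \<and> m < b \<and> f m = 0"
proof (rule ccontr)
  assume none: "\<not> ?thesis"
  have "f a \<noteq> 0" "f b \<noteq> 0"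
    using assms(2) by auto
  then have "f m \<noteq> 0" if "m \<in> {a..b}" for m
    using none that by (metis atLeastAtMost_iff less_eq_real_def)
  then have "sgn (f a) = sgn (f b)"
    using assms by (intro sgn_eq_if_no_zero_between[of "{a..b}"]) (auto simp: is_interval_cc)
  with assms(2) show False
    by (auto simp: sgn_if mult_less_0_iff split: if_splits)
qed

text \<open>This is the lower half of continuity of \<open>r\<close>. Uniqueness forces a sign
  change between any level \<open>c\<close> below \<open>r x\<close> in the gap and the end
  \<open>t x\<close>; the sign change persists for nearby \<open>y\<close>, and the zero it produces
  above \<open>c\<close> can only be \<open>r y\<close>.\<close>

lemma unique_zero_eventually_greater:
  fixes f :: "real \<Rightarrow> real \<Rightarrow> real"
  assumes f: "continuous_on UNIV (\<lambda>p. f (fst p) (snd p))"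
    and st: "continuous_on I s" "continuous_on I t"
    and r: "\<And>x. x \<in> I \<Longrightarrow> s x < r x \<and> r x < t x \<and> f x (r x) = 0"
    and unique: "\<And>x m. \<lbrakk>x \<in> I; s x < m; m < t x; f x m = 0\<rbrakk> \<Longrightarrow> m = r x"
    and sign: "\<And>x. x \<in> I \<Longrightarrow> f x (s x) * f x (t x) < 0"
    and x: "x \<in> I" "a < r x"
  shows "\<forall>\<^sub>F y in at x within I. a < r y"
proof -
  have f_comp: "continuous_on S (\<lambda>y. f (g y) (h y))" if "continuous_on S g" "continuous_on S h"
    for S and g h :: "real \<Rightarrow> real"
    using continuous_on_compose2[OF f continuous_on_Pair[OF that]] by simp
  \<comment> \<open>As \<open>a\<close> may lie below \<open>s x\<close>, it is raised to a level
    strictly inside the gap.\<close>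
  define c where "c = max a ((s x + r x) / 2)"
  have c: "s x < c" "c < r x" "a \<le> c"
    using r[OF x(1)] x(2) by (auto simp: c_def max_def field_simps)
  have "f x m \<noteq> 0" if "m \<in> {s x..c}" for m
  proof (cases "m = s x")
    case True
    then show ?thesis
      using sign[OF x(1)] by auto
  next
    case False
    then show ?thesis
      using unique[OF x(1), of m] that c r[OF x(1)] by auto
  qed
  then have "sgn (f x (s x)) = sgn (f x c)"
    using c by (intro sgn_eq_if_no_zero_between[of "{s x..c}"])
      (auto simp: is_interval_cc intro!: f_comp continuous_intros)
  then have "f x c * f x (t x) < 0"
    using sign[OF x(1)] by (auto simp: sgn_if mult_less_0_iff split: if_splits)
  moreover have "((\<lambda>y. f y c * f y (t y)) \<longlongrightarrow> f x c * f x (t x)) (at x within I)"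
  proof -
    have "continuous_on I (\<lambda>y. f y c * f y (t y))"
      by (intro continuous_intros f_comp st)
    then show ?thesis
      using x(1) by (simp add: continuous_on_def)
  qed
  ultimately have "\<forall>\<^sub>F y in at x within I. f y c * f y (t y) < 0"
    by (simp add: order_tendstoD)
  moreover have "(s \<longlongrightarrow> s x) (at x within I)" "(t \<longlongrightarrow> t x) (at x within I)"
    using st x(1) by (simp_all add: continuous_on_def)
  then have "\<forall>\<^sub>F y in at x within I. s y < c" "\<forall>\<^sub>F y in at x within I. c < t y"
    using c r[OF x(1)] by (auto intro: order_tendstoD)
  moreover have "\<forall>\<^sub>F y in at x within I. y \<in> I"
    by (simp add: eventually_at_filter)
  ultimately show ?thesis
  proof eventually_elim
    case (elim y)
    then obtain m where "c < m" "m < t y" "f y m = 0"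
      using exists_zero_between[of c "t y" "f y"] f_comp[of _ "\<lambda>_. y" "\<lambda>m. m"]
      by (auto intro: continuous_intros)
    with unique[of y m] elim c show ?case
      by auto
  qed
qed

text \<open>The upper half of continuity is the lower half for the reflected function
  \<open>f x (- m)\<close>, whose zero \<open>- r\<close> lies between \<open>- t\<close> and
  \<open>- s\<close>.\<close>

lemma continuous_on_unique_zero:
  fixes f :: "real \<Rightarrow> real \<Rightarrow> real"
  assumes f: "continuous_on UNIV (\<lambda>p. f (fst p) (snd p))"
    and st: "continuous_on I s" "continuous_on I t"
    and r: "\<And>x. x \<in> I \<Longrightarrow> s x < r x \<and> r x < t x \<and> f x (r x) = 0"
    and unique: "\<And>x m. \<lbrakk>x \<in> I; s x < m; m < t x; f x m = 0\<rbrakk> \<Longrightarrow> m = r x"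
    and sign: "\<And>x. x \<in> I \<Longrightarrow> f x (s x) * f x (t x) < 0"
  shows "continuous_on I r"
  unfolding continuous_on_def
proof (intro ballI order_tendstoI)
  fix x a assume x: "x \<in> I"
  show "\<forall>\<^sub>F y in at x within I. a < r y" if "a < r x"
    using unique_zero_eventually_greater[OF f st r unique sign x that] by blast
  show "\<forall>\<^sub>F y in at x within I. r y < a" if "r x < a"
  proof -
    have "continuous_on UNIV (\<lambda>p. f (fst p) (- snd p))"
      by (rule continuous_on_compose2[OF f, of UNIV "\<lambda>p. (fst p, - snd p)", simplified])
        (intro continuous_intros)
    then have "\<forall>\<^sub>F y in at x within I. - a < - r y"
    proof (rule unique_zero_eventually_greater[where s = "\<lambda>x. - t x" and t = "\<lambda>x. - s x"
          and r = "\<lambda>x. - r x" and f = "\<lambda>x m. f x (- m)"])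
      show "m = - r y" if "y \<in> I" "- t y < m" "m < - s y" "f y (- m) = 0" for y m
        using unique[of y "- m"] that by auto
      show "f y (- (- t y)) * f y (- (- s y)) < 0" if "y \<in> I" for y
        using sign[OF that] by (simp add: mult.commute)
    qed (use st r x that in \<open>auto intro: continuous_intros\<close>)
    then show ?thesis
      by simp
  qed
qed

section \<open>Roots as functions of the parameter\<close>

text \<open>The new roots are the roots of the derivative at which \<open>P\<close> vanishes and, in each gap between
  adjacent roots of the derivative, the unique zero of a monotone function. The bounds \<open>\<plusminus>b\<close> stand in
  for infinity.\<close>
lemma root_family_from_pderiv:
  assumes I: "is_interval I" "open I"
    and deg: "degree P > 0" and lead: "\<And>x. x \<in> I \<Longrightarrow> poly (lead_coeff P) x \<noteq> 0"
    and H: "root_family (pderiv P) I H"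
    and sign_H: "\<And>h. h \<in> H \<Longrightarrow> const_sign (\<lambda>x. bieval P x (h x)) I"
  shows "\<exists>G. root_family P I G"
proof -
  obtain b1 where b1: "continuous_on {x. poly (lead_coeff P) x \<noteq> 0} b1" "\<And>x. 0 < b1 x"
    "\<And>x m. \<lbrakk>poly (lead_coeff P) x \<noteq> 0; b1 x \<le> \<bar>m\<bar>\<rbrakk> \<Longrightarrow> bieval P x m \<noteq> 0"
    by (rule bieval_root_bound[of P]) (rule that)
  obtain b2 where b2: "continuous_on {x. poly (lead_coeff (pderiv P)) x \<noteq> 0} b2" "\<And>x. 0 < b2 x"
    "\<And>x m. \<lbrakk>poly (lead_coeff (pderiv P)) x \<noteq> 0; b2 x \<le> \<bar>m\<bar>\<rbrakk> \<Longrightarrow> bieval (pderiv P) x m \<noteq> 0"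
    by (rule bieval_root_bound[of "pderiv P"]) (rule that)
  have lead': "poly (lead_coeff (pderiv P)) x \<noteq> 0" if "x \<in> I" for x
    using H that by (auto simp: root_family_def)
  \<comment> \<open>A common bound for \<open>P\<close> and its derivative: the graphs of
    \<open>b\<close> and \<open>- b\<close> then avoid the roots of both, so they join
    \<open>H\<close> in a disjoint family.\<close>
  define b where "b x = max (b1 x) (b2 x)" for x
  have b_pos: "0 < b x" for x
    using b1(2)[of x] by (simp add: b_def less_max_iff_disj)
  have b_cont: "continuous_on I b"
    unfolding b_def using b1(1) b2(1) lead lead'
    by (intro continuous_intros) (auto elim!: continuous_on_subset)
  have b_P: "bieval P x m \<noteq> 0" if "x \<in> I" "b x \<le> \<bar>m\<bar>" for x m
    using b1(3) lead that by (simp add: b_def)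
  have b_P': "bieval (pderiv P) x m \<noteq> 0" if "x \<in> I" "b x \<le> \<bar>m\<bar>" for x m
    using b2(3) lead' that by (simp add: b_def)
  have H_zero: "bieval (pderiv P) x (h x) = 0" if "h \<in> H" "x \<in> I" for h x
    using H that by (auto simp: root_family_def)
  have H_bound: "\<bar>h x\<bar> < b x" if "h \<in> H" "x \<in> I" for h x
    using b_P'[OF that(2), of "h x"] H_zero[OF that] by linarith
  have disj_H: "disjoint_graphs I H"
    using H by (simp add: root_family_def)
  define F where "F = insert b (insert (\<lambda>x. - b x) H)"
  have "x \<notin> I \<or> (h x \<noteq> b x \<and> h x \<noteq> - b x \<and> b x \<noteq> h x \<and> - b x \<noteq> h x)" if "h \<in> H" for h x
    using H_bound[OF that] by fastforce
  moreover have "- b x \<noteq> b x" "b x \<noteq> - b x" for x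
    using b_pos[of x] by auto
  ultimately have F: "disjoint_graphs I F"
    using disj_H b_cont unfolding disjoint_graphs_def F_def
    by (auto intro!: continuous_intros)
  have sign_F: "const_sign (\<lambda>x. bieval P x (f x)) I" if "f \<in> F" for f
  proof (cases "f \<in> H")
    case True
    then show ?thesis by (rule sign_H)
  next
    case False
    then have "bieval P x (f x) \<noteq> 0" if "x \<in> I" for x
      using b_P[OF that, of "f x"] b_pos[of x] \<open>f \<in> F\<close> by (auto simp: F_def)
    moreover have "continuous_on I f"
      using F that by (auto simp: disjoint_graphs_def)
    ultimately show ?thesis
      using I by (intro const_sign_if_nonzero continuous_intros) auto
  qed
  have no_crit: "bieval (pderiv P) x m \<noteq> 0"
    if "adjacent_graphs I F s t" "x \<in> I" "s x < m" "m < t x" for s t x m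
  proof
    assume "bieval (pderiv P) x m = 0"
    then obtain h where "h \<in> H" "h x = m"
      using H \<open>x \<in> I\<close> by (auto simp: root_family_def)
    then show False
      using that unfolding adjacent_graphs_def F_def by force
  qed
  have unique: "m = m'"
    if st: "adjacent_graphs I F s t" "x \<in> I"
      and m: "s x < m" "m < t x" "bieval P x m = 0" "s x < m'" "m' < t x" "bieval P x m' = 0"
    for s t x m m'
  proof -
    have False if "s x < m" "m < m'" "m' < t x" "bieval P x m = 0" "bieval P x m' = 0" for m m'
    proof -
      obtain z where "m < z" "z < m'"
        and "bieval P x m' - bieval P x m = (m' - m) * bieval (pderiv P) x z"
        using MVT2[OF \<open>m < m'\<close>] DERIV_bieval by metis
      then have "bieval (pderiv P) x z = 0"
        using that by simp
      with no_crit[OF st, of z] that \<open>m < z\<close> \<open>z < m'\<close> show False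
        by simp
    qed
    with m show ?thesis
      by (metis linorder_neqE)
  qed
  \<comment> \<open>The derivative keeps one sign inside the gap, so \<open>P\<close> is strictly
    monotone there. Applying the mean value theorem on both sides of the zero \<open>m\<close> gives
    opposite signs at the ends, even if the derivative vanishes at the ends.\<close>
  have sign_change: "bieval P x (s x) * bieval P x (t x) < 0"
    if st: "adjacent_graphs I F s t" "x \<in> I" and m: "s x < m" "m < t x" "bieval P x m = 0"
    for s t x m
  proof -
    obtain y where y: "s x < y" "y < m"
      and "bieval P x m - bieval P x (s x) = (m - s x) * bieval (pderiv P) x y"
      using MVT2[OF m(1)] DERIV_bieval by metis
    moreover obtain z where z: "m < z" "z < t x"
      and "bieval P x (t x) - bieval P x m = (t x - m) * bieval (pderiv P) x z"
      using MVT2[OF m(2)] DERIV_bieval by metis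
    ultimately have "bieval P x (s x) = - ((m - s x) * bieval (pderiv P) x y)"
      "bieval P x (t x) = (t x - m) * bieval (pderiv P) x z"
      using m(3) by simp_all
    then have eq: "bieval P x (s x) * bieval P x (t x) =
        - ((m - s x) * (t x - m) * (bieval (pderiv P) x y * bieval (pderiv P) x z))"
      by simp
    have nz: "bieval (pderiv P) x w \<noteq> 0" if "w \<in> {s x<..<t x}" for w
      using no_crit[OF st] that by simp
    then have "sgn (bieval (pderiv P) x y) = sgn (bieval (pderiv P) x z)"
      using y z by (intro sgn_eq_if_no_zero_between[of "{s x<..<t x}"])
        (auto intro!: continuous_intros simp: is_interval_oo)
    then have "0 < bieval (pderiv P) x y * bieval (pderiv P) x z"
      using nz[of y] nz[of z] y z by (auto simp: sgn_if zero_less_mult_iff split: if_splits)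
    then show ?thesis
      unfolding eq using m by simp
  qed
  \<comment> \<open>The sign change is demanded over all of \<open>I\<close>. A gap with a zero at a
    single abscissa meets this demand, because \<open>P\<close> has constant sign along each of its
    two ends.\<close>
  define T where "T = {(s, t). adjacent_graphs I F s t \<and>
      (\<forall>x\<in>I. bieval P x (s x) * bieval P x (t x) < 0)}"
  define r where "r s t = (\<lambda>x. THE m. s x < m \<and> m < t x \<and> bieval P x m = 0)" for s t :: "real \<Rightarrow> real"
  have F_cont: "continuous_on I f" if "f \<in> F" for f
    using F that by (auto simp: disjoint_graphs_def)
  have T_adj: "adjacent_graphs I F s t" "s \<in> F" "t \<in> F" if "(s, t) \<in> T" for s t
    using that by (auto simp: T_def adjacent_graphs_def)
  have r: "s x < r s t x \<and> r s t x < t x \<and> bieval P x (r s t x) = 0" if "(s, t) \<in> T" "x \<in> I" for s t x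
  proof -
    have "s x < t x" "bieval P x (s x) * bieval P x (t x) < 0"
      using that by (auto simp: T_def adjacent_graphs_def)
    then have "\<exists>m. s x < m \<and> m < t x \<and> bieval P x m = 0"
      by (intro exists_zero_between) (auto intro!: continuous_intros)
    then have "\<exists>!m. s x < m \<and> m < t x \<and> bieval P x m = 0"
      using unique[OF T_adj(1)[OF that(1)] that(2)] by blast
    then show ?thesis
      unfolding r_def by (rule theI')
  qed
  have r_cont: "continuous_on I (r s t)" if "(s, t) \<in> T" for s t
  proof (rule continuous_on_unique_zero[where f = "bieval P" and s = s and t = t])
    show "m = r s t x" if "x \<in> I" "s x < m" "m < t x" "bieval P x m = 0" for x m
      using unique[OF T_adj(1)[OF \<open>(s, t) \<in> T\<close>]] r[OF \<open>(s, t) \<in> T\<close>] that by blast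
  qed (use r[OF that] F_cont T_adj[OF that] that in \<open>auto simp: T_def intro!: continuous_intros\<close>)
  define G where "G = {h \<in> H. \<forall>x\<in>I. bieval P x (h x) = 0} \<union> (\<lambda>(s, t). r s t) ` T"
  have H_r: "h x \<noteq> r s t x" if "h \<in> H" "(s, t) \<in> T" "x \<in> I" for h s t x
  proof -
    have "h x \<le> s x \<or> t x \<le> h x"
      using T_adj(1)[OF that(2)] that unfolding adjacent_graphs_def F_def by auto
    then show ?thesis
      using r[OF that(2,3)] by auto
  qed
  have r_r: "s = s' \<and> t = t'" if st: "(s, t) \<in> T" "(s', t') \<in> T" "x \<in> I" "r s t x = r s' t' x" for s t s' t' x
  proof -
    note a = T_adj[OF st(1)] and a' = T_adj[OF st(2)]
    \<comment> \<open>No end of one gap lies inside the other. Since the gaps share a point, their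
      ends agree at \<open>x\<close>, and disjointness identifies the graphs.\<close>
    have "s' x \<le> s x \<or> t x \<le> s' x" "t' x \<le> s x \<or> t x \<le> t' x"
      "s x \<le> s' x \<or> t' x \<le> s x" "t x \<le> s' x \<or> t' x \<le> t x"
      using a a' \<open>x \<in> I\<close> unfolding adjacent_graphs_def by auto
    then have "s x = s' x" "t x = t' x"
      using r[OF st(1,3)] r[OF st(2,3)] st(4) by linarith+
    then show ?thesis
      using F a a' \<open>x \<in> I\<close> unfolding disjoint_graphs_def by blast
  qed
  have "disjoint_graphs I G"
  proof -
    have "T \<subseteq> F \<times> F"
      using T_adj by auto
    moreover have "finite (F \<times> F)"
      using F by (simp add: disjoint_graphs_def)
    ultimately have "finite T"
      by (rule finite_subset)
    then have "finite G"
      using disj_H by (simp add: G_def disjoint_graphs_def)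
    moreover have "continuous_on I g" if "g \<in> G" for g
      using that r_cont disj_H unfolding G_def disjoint_graphs_def by auto
    moreover have "f = g" if fg: "f \<in> G" "g \<in> G" and "x \<in> I" "f x = g x" for f g x
    proof -
      consider "f \<in> H" "g \<in> H" | s t where "f \<in> H" "(s, t) \<in> T" "g = r s t"
        | s t where "g \<in> H" "(s, t) \<in> T" "f = r s t"
        | s t s' t' where "(s, t) \<in> T" "f = r s t" "(s', t') \<in> T" "g = r s' t'"
        using fg unfolding G_def by auto
      then show ?thesis
      proof cases
        case 1
        then show ?thesis
          using disj_H that unfolding disjoint_graphs_def by blast
      next
        case 2
        then show ?thesis
          using H_r[of f s t x] that by auto
      next
        case 3
        then show ?thesis
          using H_r[of g s t x] that by auto
      next
        case 4
        then show ?thesis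
          using r_r[of s t s' t' x] that by auto
      qed
    qed
    ultimately show ?thesis
      unfolding disjoint_graphs_def by blast
  qed
  moreover have "\<exists>g\<in>G. g x = m" if x: "x \<in> I" and m: "bieval P x m = 0" for x m
  proof (cases "\<exists>h\<in>H. h x = m")
    case True
    then obtain h where h: "h \<in> H" "h x = m"
      by blast
    then have "bieval P y (h y) = 0" if "y \<in> I" for y
      using const_sign_eq[OF sign_H[OF h(1)] that x] m by (simp add: sgn_zero_iff)
    with h show ?thesis
      by (auto simp: G_def)
  next
    case False
    have "\<bar>m\<bar> < b x"
      using b_P[OF x, of m] m by linarith
    then have "f x \<noteq> m" if "f \<in> F" for f
      using that False by (auto simp: F_def)
    moreover have "b \<in> F" "(\<lambda>x. - b x) \<in> F" "- b x < m" "m < b x"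
      using \<open>\<bar>m\<bar> < b x\<close> by (auto simp: F_def)
    ultimately obtain s t where st: "adjacent_graphs I F s t" "s x < m" "m < t x"
      using adjacent_graphs_exist[OF I(1) F x, of "\<lambda>x. - b x" m b] by blast
    have "bieval P y (s y) * bieval P y (t y) < 0" if "y \<in> I" for y
    proof -
      have "s \<in> F" "t \<in> F"
        using st(1) by (auto simp: adjacent_graphs_def)
      then have "sgn (bieval P y (s y)) = sgn (bieval P x (s x))"
        "sgn (bieval P y (t y)) = sgn (bieval P x (t x))"
        using const_sign_eq[OF sign_F that x] by auto
      then have "sgn (bieval P y (s y) * bieval P y (t y)) = sgn (bieval P x (s x) * bieval P x (t x))"
        by (simp add: sgn_mult)
      then show ?thesis
        using sign_change[OF st(1) x st(2,3) m] by (metis sgn_less)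
    qed
    then have T: "(s, t) \<in> T"
      using st(1) by (simp add: T_def)
    then have "r s t x = m"
      using unique[OF st(1) x] r[OF T x] st m by blast
    with T show ?thesis
      by (auto simp: G_def)
  qed
  moreover have "bieval P x (g x) = 0" if "g \<in> G" "x \<in> I" for g x
    using that r unfolding G_def by auto
  ultimately have "root_family P I G"
    unfolding root_family_def using lead by blast
  then show ?thesis ..
qed

section \<open>Eventual root functions and eventual signs along them\<close>

text \<open>A family of shrinking intervals, on which polynomial conditions are eventually constant:
  right neighbourhoods of \<open>0\<close>, or neighbourhoods of infinity.\<close>
locale germ_base =
  fixes J :: "real set set"
  assumes J_nonempty: "J \<noteq> {}"
    and J_interval: "I \<in> J \<Longrightarrow> is_interval I" and J_open: "I \<in> J \<Longrightarrow> open I"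
    and J_member_nonempty: "I \<in> J \<Longrightarrow> I \<noteq> {}" and J_pos: "I \<in> J \<Longrightarrow> I \<subseteq> {0<..}"
    and J_Int: "I \<in> J \<Longrightarrow> I' \<in> J \<Longrightarrow> I \<inter> I' \<in> J"
    and J_nonzero: "p \<noteq> 0 \<Longrightarrow> \<exists>I\<in>J. \<forall>x\<in>I. poly p x \<noteq> (0::real)"
begin

lemma J_finite_shrink:
  assumes "finite A" "I \<in> J"
    and "\<And>a. a \<in> A \<Longrightarrow> \<exists>I'\<in>J. I' \<subseteq> I \<and> Q a I'"
    and mono: "\<And>a I1 I2. Q a I1 \<Longrightarrow> I2 \<subseteq> I1 \<Longrightarrow> Q a I2"
  shows "\<exists>I'\<in>J. I' \<subseteq> I \<and> (\<forall>a\<in>A. Q a I')"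
  using assms(1,3)
proof (induction A rule: finite_induct)
  case empty
  then show ?case using \<open>I \<in> J\<close> by auto
next
  case (insert a A)
  obtain I1 where I1: "I1 \<in> J" "I1 \<subseteq> I" "\<forall>a\<in>A. Q a I1"
    using insert.IH insert.prems by auto
  obtain I2 where I2: "I2 \<in> J" "I2 \<subseteq> I" "Q a I2"
    using insert.prems by auto
  have "I1 \<inter> I2 \<in> J" "I1 \<inter> I2 \<subseteq> I" "\<forall>b\<in>insert a A. Q b (I1 \<inter> I2)"
    using I1 I2 J_Int mono[of _ I1 "I1 \<inter> I2"] mono[of _ I2 "I1 \<inter> I2"] by auto
  then show ?case by blast
qed

text \<open>The two claims feed each other. Roots of \<open>P\<close> are built from those of
  \<open>pderiv P\<close> once \<open>P\<close> has constant sign along them, which is the second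
  claim in lower degree. The sign of \<open>Q\<close> along a root of \<open>P\<close> is studied
  through its pseudo-remainder, whose roots come from the first claim in lower degree.\<close>

lemma root_family_and_const_sign:
  assumes "P \<noteq> 0"
  shows "(\<exists>I\<in>J. \<exists>G. root_family P I G) \<and>
    (\<forall>I\<in>J. \<forall>G. \<forall>g\<in>G. \<forall>Q. root_family P I G \<longrightarrow>
      (\<exists>I'\<in>J. I' \<subseteq> I \<and> const_sign (\<lambda>x. bieval Q x (g x)) I'))"
  using assms
proof (induction "degree P" arbitrary: P rule: less_induct)
  case (less P)
  obtain I0 where I0: "I0 \<in> J" "\<forall>x\<in>I0. poly (lead_coeff P) x \<noteq> 0"
    using J_nonzero[of "lead_coeff P"] less.prems by auto
  have families: "\<exists>I\<in>J. \<exists>G. root_family P I G"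
  proof (cases "degree P = 0")
    case True
    then obtain c where P: "P = [:c:]"
      by (meson degree_eq_zeroE)
    then have "root_family P I0 {}"
      using I0 unfolding root_family_def disjoint_graphs_def by auto
    with I0 show ?thesis by blast
  next
    case False
    have lt: "degree (pderiv P) < degree P" "pderiv P \<noteq> 0"
      using False by (simp_all add: degree_pderiv pderiv_eq_0_iff)
    obtain I1 H where H: "I1 \<in> J" "root_family (pderiv P) I1 H"
      using less.hyps[OF lt] by blast
    have "\<exists>I'\<in>J. I' \<subseteq> I1 \<and> const_sign (\<lambda>x. bieval P x (h x)) I'" if "h \<in> H" for h
      using less.hyps[OF lt] H that by blast
    moreover have "finite H"
      using H by (auto simp: root_family_def disjoint_graphs_def)
    ultimately obtain I2 where I2: "I2 \<in> J" "I2 \<subseteq> I1"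
      "\<forall>h\<in>H. const_sign (\<lambda>x. bieval P x (h x)) I2"
      using J_finite_shrink[of H I1 "\<lambda>h. const_sign (\<lambda>x. bieval P x (h x))"] H(1) const_sign_subset
      by blast
    let ?I = "I0 \<inter> I2"
    have "?I \<in> J"
      using I0 I2 J_Int by blast
    then have "\<exists>G. root_family P ?I G"
      using False I0 I2 H J_interval J_open
      by (intro root_family_from_pderiv[of ?I P H])
        (auto intro: root_family_subset const_sign_subset)
    with \<open>?I \<in> J\<close> show ?thesis by blast
  qed
  have "\<exists>I'\<in>J. I' \<subseteq> I \<and> const_sign (\<lambda>x. bieval Q x (g x)) I'"
    if I: "I \<in> J" and G: "root_family P I G" "g \<in> G" for I G g Q
  proof -
    \<comment> \<open>Pseudo-division multiplies \<open>Q\<close> by a power of the leading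
      coefficient of \<open>P\<close>, which has no zero on \<open>I\<close>. Hence \<open>Q\<close>
      and \<open>R\<close> vanish at the same points of the graph of \<open>g\<close>.\<close>
    obtain D R where "pseudo_divmod Q P = (D, R)"
      by fastforce
    from pseudo_divmod[OF less.prems this]
    obtain k where k: "smult (lead_coeff P ^ k) Q = P * D + R" and R: "R = 0 \<or> degree R < degree P"
      by blast
    have g_zero: "bieval P x (g x) = 0" and lead: "poly (lead_coeff P) x \<noteq> 0" if "x \<in> I" for x
      using G that by (auto simp: root_family_def)
    have g_cont: "continuous_on I g"
      using G by (auto simp: root_family_def disjoint_graphs_def)
    have QR: "poly (lead_coeff P) x ^ k * bieval Q x (g x) = bieval R x (g x)" if "x \<in> I" for x
      using arg_cong[OF k, of "\<lambda>p. bieval p x (g x)"] g_zero[OF that] by simp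
    then have QR0: "bieval Q x (g x) = 0 \<longleftrightarrow> bieval R x (g x) = 0" if "x \<in> I" for x
      using lead[OF that] that by (metis mult_eq_0_iff power_not_zero)
    show ?thesis
    proof (cases "R = 0")
      case True
      then have "const_sign (\<lambda>x. bieval Q x (g x)) I"
        using QR0 by (auto simp: const_sign_def)
      with I show ?thesis by blast
    next
      case False
      with R have lt: "degree R < degree P"
        by simp
      obtain I1 K where K: "I1 \<in> J" "root_family R I1 K"
        using less.hyps[OF lt False] by blast
      \<comment> \<open>The roles are exchanged here: \<open>R\<close> has smaller degree, so the
        sign of \<open>P\<close> along the roots of \<open>R\<close> is eventually constant.\<close>
      have "\<exists>I'\<in>J. I' \<subseteq> I1 \<and> const_sign (\<lambda>x. bieval P x (h x)) I'" if "h \<in> K" for h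
        using less.hyps[OF lt False] K that by blast
      moreover have "finite K"
        using K by (auto simp: root_family_def disjoint_graphs_def)
      ultimately obtain I2 where I2: "I2 \<in> J" "I2 \<subseteq> I1"
        "\<forall>h\<in>K. const_sign (\<lambda>x. bieval P x (h x)) I2"
        using J_finite_shrink[of K I1 "\<lambda>h. const_sign (\<lambda>x. bieval P x (h x))"] K(1) const_sign_subset
        by blast
      let ?I = "I \<inter> I2"
      have I': "?I \<in> J"
        using I I2 J_Int by blast
      have "const_sign (\<lambda>x. bieval Q x (g x)) ?I"
      \<comment> \<open>If \<open>R\<close> vanishes at one point of the graph of \<open>g\<close>,
        some root \<open>h\<close> of \<open>R\<close> passes through it. Then \<open>P\<close>
        vanishes all along \<open>h\<close>, so \<open>h\<close> follows a single member of
        \<open>G\<close>, which must be \<open>g\<close>; thus \<open>R\<close> vanishes all along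
        \<open>g\<close>. Otherwise \<open>Q\<close> has no zero along \<open>g\<close>.\<close>
      proof (cases "\<exists>x\<in>?I. bieval R x (g x) = 0")
        case True
        then obtain x where x: "x \<in> ?I" "bieval R x (g x) = 0"
          by blast
        then obtain h where h: "h \<in> K" "h x = g x"
          using root_family_zero_iff[OF K(2), of x "g x"] I2 by blast
        have "sgn (bieval P y (h y)) = sgn (bieval P x (h x))" if "y \<in> ?I" for y
          using I2(3) h(1) that x(1) by (intro const_sign_eq[of "\<lambda>y. bieval P y (h y)" I2]) auto
        then have "bieval P y (h y) = 0" if "y \<in> ?I" for y
          using that g_zero[of x] x h by (simp add: sgn_zero_iff)
        then have "\<exists>f\<in>G. h y = f y" if "y \<in> ?I" for y
          using root_family_zero_iff[OF G(1), of y "h y"] that by (metis IntD1)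
        moreover have "disjoint_graphs ?I G"
          using root_family_subset[OF G(1), of ?I] by (simp add: root_family_def)
        moreover have "continuous_on ?I h"
          using root_family_subset[OF K(2) I2(2)] h(1)
          by (auto simp: root_family_def disjoint_graphs_def intro: continuous_on_subset)
        ultimately obtain f where f: "f \<in> G" "\<forall>y\<in>?I. h y = f y"
          using disjoint_graphs_select[of ?I G h] I' J_interval J_member_nonempty by blast
        then have "f = g"
          using G x h unfolding root_family_def disjoint_graphs_def by (metis IntD1)
        moreover have "bieval R y (h y) = 0" if "y \<in> ?I" for y
          using root_family_zero_iff[OF K(2), of y "h y"] h I2 that by blast
        ultimately have "bieval Q y (g y) = 0" if "y \<in> ?I" for y
          using f that QR0[of y] by auto
        then show ?thesis
          by (auto simp: const_sign_def)
      next
        case False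
        then show ?thesis
          using QR0 I' J_interval g_cont
          by (intro const_sign_if_nonzero continuous_intros) (auto elim: continuous_on_subset)
      qed
      with I' show ?thesis by blast
    qed
  qed
  with families show ?case by blast
qed

end

section \<open>Monotonicity of roots\<close>

text \<open>\<open>map_poly pderiv P\<close> is the partial derivative in \<open>x\<close>.
  Continuity of \<open>f\<close> suffices: in Horner's scheme \<open>f x\<close> multiplies an
  increment that vanishes at \<open>a\<close>, so only its limit enters.\<close>

lemma DERIV_bieval_increment:
  assumes "isCont f a"
  shows "((\<lambda>x. bieval P x (f x) - bieval P a (f x)) has_real_derivative
    bieval (map_poly pderiv P) a (f a)) (at a)"
proof (induction P)
  case 0
  then show ?case by simp
next
  case (pCons c P)
  let ?D = "\<lambda>x. bieval P x (f x) - bieval P a (f x)" and ?d = "bieval (map_poly pderiv P) a (f a)"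
  have "((\<lambda>x. (?D x - ?D a) / (x - a)) \<longlongrightarrow> ?d) (at a)"
    using pCons by (simp add: has_field_derivative_iff)
  moreover have "(f \<longlongrightarrow> f a) (at a)"
    using assms by (simp add: isCont_def)
  ultimately have "((\<lambda>x. f x * ((?D x - ?D a) / (x - a))) \<longlongrightarrow> f a * ?d) (at a)"
    by (rule tendsto_mult[rotated])
  then have "((\<lambda>x. f x * ?D x) has_real_derivative f a * ?d) (at a)"
    by (simp add: has_field_derivative_iff)
  moreover have "((\<lambda>x. poly c x - poly c a) has_real_derivative poly (pderiv c) a) (at a)"
    by (auto intro!: derivative_eq_intros)
  ultimately have "((\<lambda>x. poly c x - poly c a + f x * ?D x) has_real_derivative
      poly (pderiv c) a + f a * ?d) (at a)"
    by (intro DERIV_add)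
  then show ?case
    by (simp add: map_poly_pCons algebra_simps)
qed

text \<open>The equation \<open>bieval P x (g x) = 0\<close> splits into the increment
  \<open>?D x\<close> in the first argument and the increment of \<open>bieval P a\<close> from
  \<open>g a\<close> to \<open>g x\<close>. Writing the latter as
  \<open>\<phi> (g x) * (g x - g a)\<close> and dividing by \<open>x - a\<close> isolates the
  difference quotient of \<open>g\<close>.\<close>

lemma DERIV_implicit_root:
  assumes I: "open I" "a \<in> I" and g: "continuous_on I g" "\<And>x. x \<in> I \<Longrightarrow> bieval P x (g x) = 0"
    and nz: "bieval (pderiv P) a (g a) \<noteq> 0"
  shows "(g has_real_derivative
    - (bieval (map_poly pderiv P) a (g a) / bieval (pderiv P) a (g a))) (at a)"
proof -
  have cont: "isCont g a"
    using I g(1) continuous_on_eq_continuous_at by blast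
  obtain \<phi> where \<phi>: "\<And>z. bieval P a z - bieval P a (g a) = \<phi> z * (z - g a)"
    "isCont \<phi> (g a)" "\<phi> (g a) = bieval (pderiv P) a (g a)"
    using DERIV_bieval[of P a "g a"] unfolding CARAT_DERIV by blast
  let ?D = "\<lambda>x. bieval P x (g x) - bieval P a (g x)"
  have "((\<lambda>x. (?D x - ?D a) / (x - a)) \<longlongrightarrow> bieval (map_poly pderiv P) a (g a)) (at a)"
    using DERIV_bieval_increment[OF cont] by (simp add: has_field_derivative_iff)
  moreover have \<phi>_lim: "((\<lambda>x. \<phi> (g x)) \<longlongrightarrow> bieval (pderiv P) a (g a)) (at a)"
    using isCont_o2[OF cont \<phi>(2)] \<phi>(3) by (simp add: isCont_def)
  ultimately have lim: "((\<lambda>x. - ((?D x - ?D a) / (x - a) / \<phi> (g x))) \<longlongrightarrow>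
      - (bieval (map_poly pderiv P) a (g a) / bieval (pderiv P) a (g a))) (at a)"
    using nz by (intro tendsto_intros)
  have "\<forall>\<^sub>F x in at a. \<phi> (g x) \<noteq> 0"
    using \<phi>_lim nz by (rule tendsto_imp_eventually_ne)
  moreover have "\<forall>\<^sub>F x in at a. x \<in> I"
    using I eventually_at_topological by blast
  ultimately have "\<forall>\<^sub>F x in at a. - ((?D x - ?D a) / (x - a) / \<phi> (g x)) = (g x - g a) / (x - a)"
  proof eventually_elim
    case (elim x)
    have "?D x - ?D a = - (\<phi> (g x) * (g x - g a))"
      using \<phi>(1)[of "g x"] g(2)[of a] g(2)[of x] elim I by simp
    with elim show ?case
      by simp
  qed
  with lim show ?thesis
    unfolding has_field_derivative_iff by (rule Lim_transform_eventually)
qed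

context germ_base
begin

text \<open>The implicit derivative of \<open>g\<close> is a quotient of two polynomials along
  \<open>g\<close>, both of eventually constant sign. If its denominator vanishes along
  \<open>g\<close>, then \<open>g\<close> eventually coincides with a root function of
  \<open>pderiv P\<close>, which has smaller degree.\<close>

lemma root_eventually_monotone:
  assumes "P \<noteq> 0" "I \<in> J" "root_family P I G" "g \<in> G"
  shows "\<exists>I'\<in>J. I' \<subseteq> I \<and> (mono_on I' g \<or> antimono_on I' g)"
  using assms
proof (induction "degree P" arbitrary: P I G g rule: less_induct)
  case (less P)
  have g_cont: "continuous_on I g"
    using less.prems by (auto simp: root_family_def disjoint_graphs_def)
  have g_zero: "bieval P x (g x) = 0" if "x \<in> I" for x
    using root_family_zero_iff[OF less.prems(3) that] less.prems(4) by blast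
  have "\<exists>I'\<in>J. I' \<subseteq> I \<and> const_sign (\<lambda>x. bieval Q x (g x)) I'" for Q
    using root_family_and_const_sign[OF less.prems(1)] less.prems(2-4) by blast
  then obtain I1 I2 where I1: "I1 \<in> J" "I1 \<subseteq> I" "const_sign (\<lambda>x. bieval (pderiv P) x (g x)) I1"
    and I2: "I2 \<in> J" "I2 \<subseteq> I" "const_sign (\<lambda>x. bieval (map_poly pderiv P) x (g x)) I2"
    by meson
  show ?case
  proof (cases "\<exists>x\<in>I1. bieval (pderiv P) x (g x) = 0")
    case True
    then have g_zero': "bieval (pderiv P) x (g x) = 0" if "x \<in> I1" for x
      using const_sign_eq[OF I1(3)] that by (metis sgn_zero_iff)
    have "degree P \<noteq> 0"
    proof
      assume "degree P = 0"
      then obtain c where c: "P = [:c:]"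
        by (meson degree_eq_zeroE)
      obtain x where "x \<in> I"
        using J_member_nonempty less.prems(2) by blast
      then show False
        using g_zero[of x] less.prems(3) c by (auto simp: root_family_def)
    qed
    then have lt: "degree (pderiv P) < degree P" and nz: "pderiv P \<noteq> 0"
      by (simp_all add: degree_pderiv pderiv_eq_0_iff)
    obtain I3 H where H: "I3 \<in> J" "root_family (pderiv P) I3 H"
      using root_family_and_const_sign[OF nz] by blast
    let ?I = "I1 \<inter> I3"
    have "?I \<in> J"
      using I1 H J_Int by blast
    moreover have "disjoint_graphs ?I H"
      using root_family_subset[OF H(2), of ?I] by (simp add: root_family_def)
    moreover have "continuous_on ?I g"
      using g_cont I1(2) by (auto intro: continuous_on_subset)
    moreover have "\<exists>h\<in>H. g x = h x" if "x \<in> ?I" for x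
      using root_family_zero_iff[OF H(2), of x "g x"] g_zero'[of x] that by (metis IntD1 IntD2)
    ultimately obtain h where h: "h \<in> H" "\<forall>x\<in>?I. g x = h x"
      using disjoint_graphs_select[of ?I H g] J_interval J_member_nonempty by blast
    obtain I4 where I4: "I4 \<in> J" "I4 \<subseteq> I3" "mono_on I4 h \<or> antimono_on I4 h"
      using less.hyps[OF lt nz H h(1)] by blast
    have "I4 \<inter> ?I \<in> J"
      using I4(1) \<open>?I \<in> J\<close> J_Int by blast
    moreover have "I4 \<inter> ?I \<subseteq> I"
      using I1 by blast
    moreover have "mono_on (I4 \<inter> ?I) g \<or> antimono_on (I4 \<inter> ?I) g"
      using I4(3) h(2) unfolding monotone_on_def by auto
    ultimately show ?thesis
      by blast
  next
    case False
    let ?I = "I1 \<inter> I2"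
    let ?g' = "\<lambda>x. - (bieval (map_poly pderiv P) x (g x) / bieval (pderiv P) x (g x))"
    have "?I \<in> J"
      using I1 I2 J_Int by blast
    have deriv: "(g has_real_derivative ?g' x) (at x)" if "x \<in> ?I" for x
      using that less.prems(2) J_open I1 I2 g_cont g_zero False by (intro DERIV_implicit_root[of I]) auto
    have "const_sign ?g' ?I"
      using I1(3) I2(3) unfolding const_sign_def by (fastforce simp: sgn_divide)
    then have sign: "(\<forall>x\<in>?I. 0 \<le> ?g' x) \<or> (\<forall>x\<in>?I. ?g' x \<le> 0)"
      unfolding const_sign_def by (metis linorder_le_cases sgn_greater sgn_less linorder_not_le)
    have seg: "z \<in> ?I" if "x \<in> ?I" "y \<in> ?I" "x \<le> z" "z \<le> y" for x y z
      using J_interval[OF \<open>?I \<in> J\<close>] that unfolding is_interval_1 by blast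
    from sign have "mono_on ?I g \<or> antimono_on ?I g"
    proof
      assume le: "\<forall>x\<in>?I. 0 \<le> ?g' x"
      have "g x \<le> g y" if "x \<in> ?I" "y \<in> ?I" "x \<le> y" for x y
        using \<open>x \<le> y\<close>
      proof (rule DERIV_nonneg_imp_nondecreasing)
        fix z assume "x \<le> z" "z \<le> y"
        then have "z \<in> ?I"
          using seg that by blast
        then show "\<exists>d. (g has_real_derivative d) (at z) \<and> 0 \<le> d"
          using le deriv by blast
      qed
      then show ?thesis
        by (intro disjI1 monotone_onI)
    next
      assume le: "\<forall>x\<in>?I. ?g' x \<le> 0"
      have "g y \<le> g x" if "x \<in> ?I" "y \<in> ?I" "x \<le> y" for x y
        using \<open>x \<le> y\<close>
      proof (rule DERIV_nonpos_imp_nonincreasing)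
        fix z assume "x \<le> z" "z \<le> y"
        then have "z \<in> ?I"
          using seg that by blast
        then show "\<exists>d. (g has_real_derivative d) (at z) \<and> d \<le> 0"
          using le deriv by blast
      qed
      then show ?thesis
        by (intro disjI2 monotone_onI)
    qed
    then show ?thesis
      using \<open>?I \<in> J\<close> I1 by blast
  qed
qed

end

section \<open>Sign cells\<close>

text \<open>Away from the roots, both points lie in the same gap between adjacent graphs. A vertical
  move to the middle of the gap, a path along the middle curve and another vertical move join them
  without meeting a root.\<close>

lemma sgn_bieval_eq_on_cell:
  assumes I: "is_interval I" and G: "root_family P I G" and x: "x \<in> I" "x' \<in> I"
    and cell: "\<And>g. g \<in> G \<Longrightarrow> (m < g x \<longleftrightarrow> m' < g x') \<and> (g x < m \<longleftrightarrow> g x' < m')"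
  shows "sgn (bieval P x m) = sgn (bieval P x' m')"
proof (cases "\<exists>g\<in>G. g x = m")
  case True
  then have "\<exists>g\<in>G. g x' = m'"
    using cell by (metis less_irrefl linorder_neqE)
  with True have "bieval P x m = 0" "bieval P x' m' = 0"
    using root_family_zero_iff[OF G] x by blast+
  then show ?thesis by simp
next
  case False
  obtain b where b: "continuous_on {x. poly (lead_coeff P) x \<noteq> 0} b" "\<And>x. 0 < b x"
    "\<And>x m. \<lbrakk>poly (lead_coeff P) x \<noteq> 0; b x \<le> \<bar>m\<bar>\<rbrakk> \<Longrightarrow> bieval P x m \<noteq> 0"
    by (rule bieval_root_bound[of P]) (rule that)
  \<comment> \<open>Exceeding the root bound and both given ordinates, \<open>B\<close> and
    \<open>- B\<close> turn the unbounded outer cells into gaps between graphs.\<close>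
  define B where "B y = b y + \<bar>m\<bar> + \<bar>m'\<bar>" for y
  define F where "F = insert B (insert (\<lambda>y. - B y) G)"
  have lead: "poly (lead_coeff P) y \<noteq> 0" if "y \<in> I" for y
    using G that by (auto simp: root_family_def)
  have B_gt: "\<bar>m\<bar> < B y" "\<bar>m'\<bar> < B y" for y
    using b(2)[of y] by (auto simp: B_def)
  have G_bound: "\<bar>g y\<bar> < B y" if "g \<in> G" "y \<in> I" for g y
  proof -
    have "bieval P y (g y) = 0"
      using root_family_zero_iff[OF G that(2)] that(1) by blast
    then have "\<bar>g y\<bar> < b y"
      using b(3)[OF lead[OF that(2)], of "g y"] by linarith
    then show ?thesis
      by (simp add: B_def)
  qed
  have "continuous_on I B"
    unfolding B_def using b(1) lead by (intro continuous_intros) (auto elim!: continuous_on_subset)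
  moreover have "y \<notin> I \<or> (g y \<noteq> B y \<and> g y \<noteq> - B y \<and> B y \<noteq> g y \<and> - B y \<noteq> g y)" if "g \<in> G" for g y
    using G_bound[OF that] by fastforce
  moreover have "- B y \<noteq> B y" "B y \<noteq> - B y" for y
    using B_gt(1)[of y] by auto
  ultimately have F: "disjoint_graphs I F"
    using G unfolding root_family_def disjoint_graphs_def F_def
    by (auto intro!: continuous_intros)
  have "f x \<noteq> m" if "f \<in> F" for f
    using that False B_gt(1)[of x] by (auto simp: F_def)
  moreover have "B \<in> F" "(\<lambda>y. - B y) \<in> F" "- B x < m" "m < B x"
    using B_gt(1)[of x] by (auto simp: F_def)
  ultimately obtain s t where st: "adjacent_graphs I F s t" "s x < m" "m < t x"
    using adjacent_graphs_exist[OF I F x(1), of "\<lambda>y. - B y" m B] by blast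
  have "s \<in> F" "t \<in> F"
    using st(1) by (auto simp: adjacent_graphs_def)
  then have st': "s x' < m'" "m' < t x'"
    using st(2,3) cell[of s] cell[of t] B_gt[of x] B_gt[of x'] by (auto simp: F_def)
  have nz: "bieval P y w \<noteq> 0" if y: "y \<in> I" "s y < w" "w < t y" for y w
  proof
    assume "bieval P y w = 0"
    then obtain g where "g \<in> G" "g y = w"
      using root_family_zero_iff[OF G y(1)] by blast
    then show False
      using st(1) y unfolding adjacent_graphs_def F_def by force
  qed
  define \<mu> where "\<mu> y = (s y + t y) / 2" for y
  have \<mu>: "s y < \<mu> y" "\<mu> y < t y" if "y \<in> I" for y
    using st(1) that by (auto simp: adjacent_graphs_def \<mu>_def)
  have vertical: "sgn (bieval P y w) = sgn (bieval P y (\<mu> y))" if "y \<in> I" "s y < w" "w < t y" for y w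
    using nz \<mu> that
    by (intro sgn_eq_if_no_zero_between[of "{s y<..<t y}"])
      (auto intro!: continuous_intros simp: is_interval_oo)
  have "continuous_on I \<mu>"
    unfolding \<mu>_def using F \<open>s \<in> F\<close> \<open>t \<in> F\<close>
    by (intro continuous_intros) (auto simp: disjoint_graphs_def)
  then have "sgn (bieval P x (\<mu> x)) = sgn (bieval P x' (\<mu> x'))"
    using I x \<mu> nz
    by (intro sgn_eq_if_no_zero_between[of I "\<lambda>y. bieval P y (\<mu> y)"] continuous_intros) auto
  then show ?thesis
    using vertical[OF x(1) st(2,3)] vertical[OF x(2) st'] by simp
qed

context germ_base
begin

text \<open>Once \<open>I\<close> is so small that all root functions are monotone over it, the sets
  below and above their graphs lie in the algebra. Membership in these finitely many sets fixes the
  cell of a point over \<open>I\<close>, hence the sign of \<open>P\<close>.\<close>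

lemma eventually_semigroup_algebra_slope:
  "\<exists>I\<in>J. {v :: real ^ 'n. v $ i \<in> I \<and> R (sgn (bieval P (v $ i) (v $ j / v $ i)))} \<in> semigroup_algebra"
proof (cases "P = 0")
  case True
  obtain I where "I \<in> J"
    using J_nonempty by blast
  then have "{v :: real ^ 'n. v $ i \<in> I} \<in> semigroup_algebra"
    by (intro semigroup_algebra_interval J_pos J_interval J_member_nonempty)
  with True \<open>I \<in> J\<close> show ?thesis
    by (cases "R 0") (auto simp: semigroup_algebra_empty)
next
  case False
  then obtain I0 G where G: "I0 \<in> J" "root_family P I0 G"
    using root_family_and_const_sign by blast
  have "\<exists>I\<in>J. I \<subseteq> I0 \<and> (\<forall>g\<in>G. mono_on I g \<or> antimono_on I g)"
  proof (rule J_finite_shrink)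
    show "finite G"
      using G by (simp add: root_family_def disjoint_graphs_def)
    show "\<exists>I\<in>J. I \<subseteq> I0 \<and> (mono_on I g \<or> antimono_on I g)" if "g \<in> G" for g
      using root_eventually_monotone[OF False G that] .
  qed (use G in \<open>auto intro: monotone_on_subset\<close>)
  then obtain I where I: "I \<in> J" "I \<subseteq> I0" "\<forall>g\<in>G. mono_on I g \<or> antimono_on I g"
    by blast
  note I' = J_pos[OF I(1)] J_interval[OF I(1)] J_member_nonempty[OF I(1)]
  define L U where "L g = {v :: real ^ 'n. v $ i \<in> I \<and> v $ j < v $ i * g (v $ i)}"
    and "U g = {v :: real ^ 'n. v $ i \<in> I \<and> v $ j > v $ i * g (v $ i)}" for g
  let ?F = "insert {v. v $ i \<in> I} (L ` G \<union> U ` G)"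
  have "{v. v $ i \<in> I \<and> R (sgn (bieval P (v $ i) (v $ j / v $ i)))} \<in> semigroup_algebra"
  proof (rule semigroup_algebra_determined[of ?F])
    show "finite ?F"
      using G by (simp add: root_family_def disjoint_graphs_def)
    show "?F \<subseteq> semigroup_algebra"
      using semigroup_algebra_interval[OF I'] semigroup_algebra_below_monotone_slope[OF I'] I(3)
      unfolding L_def U_def by blast
    fix v w :: "real ^ 'n"
    assume same: "\<And>A. A \<in> ?F \<Longrightarrow> v \<in> A \<longleftrightarrow> w \<in> A"
      and v: "v \<in> {v. v $ i \<in> I \<and> R (sgn (bieval P (v $ i) (v $ j / v $ i)))}"
    then have "v $ i \<in> I" "w $ i \<in> I"
      by auto
    then have pos: "0 < v $ i" "0 < w $ i"
      using I'(1) by auto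
    have "sgn (bieval P (v $ i) (v $ j / v $ i)) = sgn (bieval P (w $ i) (w $ j / w $ i))"
    proof (rule sgn_bieval_eq_on_cell[OF I'(2) root_family_subset[OF G(2) I(2)]])
      fix g assume "g \<in> G"
      then have "v \<in> L g \<longleftrightarrow> w \<in> L g" "v \<in> U g \<longleftrightarrow> w \<in> U g"
        using same by auto
      then show "(v $ j / v $ i < g (v $ i) \<longleftrightarrow> w $ j / w $ i < g (w $ i)) \<and>
          (g (v $ i) < v $ j / v $ i \<longleftrightarrow> g (w $ i) < w $ j / w $ i)"
        using \<open>v $ i \<in> I\<close> \<open>w $ i \<in> I\<close> pos
        by (simp add: L_def U_def pos_divide_less_eq pos_less_divide_eq mult.commute)
    qed fact+
    then show "w \<in> {v. v $ i \<in> I \<and> R (sgn (bieval P (v $ i) (v $ j / v $ i)))}"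
      using v \<open>w $ i \<in> I\<close> by simp
  qed
  with I(1) show ?thesis
    by blast
qed

lemma eventually_semigroup_algebra:
  "\<exists>I\<in>J. {v :: real ^ 'n. v $ i \<in> I \<and> R (sgn (bieval P (v $ i) (v $ j)))} \<in> semigroup_algebra"
proof -
  \<comment> \<open>The inner polynomial \<open>[:0, [:0, 1:]:]\<close> is \<open>x * m\<close>, so
    \<open>Q\<close> is \<open>P\<close> rewritten in abscissa and slope.\<close>
  define Q where "Q = pcompose P [:0, [:0, 1:]:]"
  have "bieval Q x m = bieval P x (x * m)" for x m
    unfolding Q_def bieval_def[of "pcompose _ _"] poly_pcompose poly_poly_eq_bieval
    by (simp add: mult.commute)
  then have "bieval Q (v $ i) (v $ j / v $ i) = bieval P (v $ i) (v $ j)"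
    if "v $ i \<in> I" "I \<in> J" for v :: "real ^ 'n" and I
    using that J_pos by fastforce
  then have eq: "{v :: real ^ 'n. v $ i \<in> I \<and> R (sgn (bieval P (v $ i) (v $ j)))} =
      {v. v $ i \<in> I \<and> R (sgn (bieval Q (v $ i) (v $ j / v $ i)))}" if "I \<in> J" for I
    using that by auto
  obtain I where "I \<in> J"
    "{v :: real ^ 'n. v $ i \<in> I \<and> R (sgn (bieval Q (v $ i) (v $ j / v $ i)))} \<in> semigroup_algebra"
    using eventually_semigroup_algebra_slope by blast
  with eq[of I] show ?thesis
    by (intro bexI[of _ I]) simp_all
qed

end

section \<open>The two germs: at zero from the right and at infinity\<close>

lemma germ_base_at_zero: "germ_base {{0<..<e} | e. 0 < e}"
proof
  show "\<exists>I\<in>{{0<..<e} | e. 0 < e}. \<forall>x\<in>I. poly p x \<noteq> (0::real)" if "p \<noteq> 0" for p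
  proof -
    \<comment> \<open>The extra element 1 keeps the set nonempty, so its minimum is a positive
      radius even if \<open>p\<close> has no positive root.\<close>
    let ?Z = "insert 1 {x. poly p x = 0 \<and> 0 < x}"
    have fin: "finite ?Z"
      using poly_roots_finite[OF that] by (auto elim: finite_subset[rotated])
    then have "Min ?Z \<in> ?Z"
      by (intro Min_in) auto
    then have "0 < Min ?Z"
      by auto
    moreover have "poly p x \<noteq> 0" if "x \<in> {0<..<Min ?Z}" for x
      using Min_le[OF fin, of x] that by auto
    ultimately show ?thesis
      by blast
  qed
  fix I I' :: "real set"
  assume "I \<in> {{0<..<e} | e. 0 < e}"
  then obtain e where e: "I = {0<..<e}" "0 < e"
    by blast
  show "I \<inter> I' \<in> {{0<..<e} | e. 0 < e}" if "I' \<in> {{0<..<e} | e. 0 < e}"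
  proof -
    from that obtain e' where "I' = {0<..<e'}" "0 < e'"
      by blast
    with e have "I \<inter> I' = {0<..<min e e'}" "0 < min e e'"
      by auto
    then show ?thesis
      by blast
  qed
qed (auto simp: is_interval_oo intro: exI[of _ 1])

lemma germ_base_at_infinity: "germ_base {{r<..} | r. 0 < r}"
proof
  show "\<exists>I\<in>{{r<..} | r. 0 < r}. \<forall>x\<in>I. poly p x \<noteq> (0::real)" if "p \<noteq> 0" for p
  proof -
    \<comment> \<open>Here the extra element 1 makes the maximum positive.\<close>
    let ?Z = "insert 1 {x. poly p x = 0}"
    have fin: "finite ?Z"
      using poly_roots_finite[OF that] by simp
    then have "1 \<le> Max ?Z"
      by (intro Max_ge) auto
    then have "0 < Max ?Z"
      by linarith
    moreover have "poly p x \<noteq> 0" if "x \<in> {Max ?Z<..}" for x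
      using Max_ge[OF fin, of x] that by auto
    ultimately show ?thesis
      by blast
  qed
  fix I I' :: "real set"
  assume "I \<in> {{r<..} | r. 0 < r}"
  then obtain r where r: "I = {r<..}" "0 < r"
    by blast
  show "is_interval I" "open I" "I \<subseteq> {0<..}"
    using r by (auto simp: is_interval_1)
  have "r + 1 \<in> I"
    using r by simp
  then show "I \<noteq> {}"
    by blast
  show "I \<inter> I' \<in> {{r<..} | r. 0 < r}" if "I' \<in> {{r<..} | r. 0 < r}"
  proof -
    from that obtain r' where "I' = {r'<..}" "0 < r'"
      by blast
    with r have "I \<inter> I' = {max r r'<..}" "0 < max r r'"
      by auto
    then show ?thesis
      by blast
  qed
qed (use zero_less_one in blast)

section \<open>Semialgebraic sets\<close>

text \<open>Both germs control the two ends of the half-space, and the part between them is an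
  arbitrary subset of a bounded strip away from 0.\<close>

lemma semigroup_algebra_positive_coord:
  "{v :: real ^ 'n. 0 < v $ i \<and> R (sgn (bieval P (v $ i) (v $ j)))} \<in> semigroup_algebra"
proof -
  let ?S = "\<lambda>I. {v :: real ^ 'n. v $ i \<in> I \<and> R (sgn (bieval P (v $ i) (v $ j)))}"
  obtain e where e: "0 < e" "?S {0<..<e} \<in> semigroup_algebra"
    using germ_base.eventually_semigroup_algebra[OF germ_base_at_zero, of i R P j] by blast
  obtain r where r: "0 < r" "?S {r<..} \<in> semigroup_algebra"
    using germ_base.eventually_semigroup_algebra[OF germ_base_at_infinity, of i R P j] by blast
  have "?S {e..r} \<in> semigroup_algebra"
    by (rule semigroup_algebra_bounded_strip[OF e(1), of _ i r]) auto
  \<comment> \<open>For \<open>r < e\<close> the middle interval is empty and the two outer ones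
    overlap.\<close>
  moreover have "{0<..} = {0<..<e} \<union> {e..r} \<union> {r<..}"
    using e(1) r(1) by auto
  then have "{v :: real ^ 'n. 0 < v $ i \<and> R (sgn (bieval P (v $ i) (v $ j)))} =
      ?S {0<..<e} \<union> ?S {e..r} \<union> ?S {r<..}"
    by (auto simp: set_eq_iff)
  ultimately show ?thesis
    using e(2) r(2) by (simp only: semigroup_algebra_Un)
qed

lemma bieval_fixed_abscissa: "\<exists>r. \<forall>y. bieval P x y = poly r y"
proof (induction P)
  case 0
  show ?case
    by (rule exI[of _ 0]) simp
next
  case (pCons a P)
  then obtain r where "\<forall>y. bieval P x y = poly r y"
    by blast
  then show ?case
    by (intro exI[of _ "pCons (poly a x) r"]) simp
qed

text \<open>The indices \<open>i\<close> and \<open>j\<close> may coincide, which covers dimension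
  1; the linear case then uses the first variable alone, so that the single coordinate is counted
  once.\<close>

lemma real_polynomial_function_bieval:
  fixes p :: "real ^ 'n \<Rightarrow> real"
  assumes UNIV: "(UNIV :: 'n set) = {i, j}" and "real_polynomial_function p"
  shows "\<exists>P. \<forall>v. p v = bieval P (v $ i) (v $ j)"
  using assms(2)
proof (induction p rule: real_polynomial_function.induct)
  case (linear f)
  define c where "c k = f (axis k 1)" for k
  have f: "f v = (\<Sum>k\<in>{i, j}. v $ k * c k)" for v
  proof -
    have "f v = f (\<Sum>k\<in>UNIV. v $ k *\<^sub>R axis k 1)"
      by (metis basis_expansion scalar_mult_eq_scaleR)
    also have "\<dots> = (\<Sum>k\<in>UNIV. v $ k * c k)"
      using bounded_linear.linear[OF linear] by (simp add: linear_sum linear_scale c_def)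
    finally show ?thesis
      using UNIV by simp
  qed
  show ?case
  proof (cases "i = j")
    case True
    then show ?thesis
      using f by (intro exI[of _ "[:[:0, c i:]:]"]) (simp add: mult.commute)
  next
    case False
    then show ?thesis
      using f by (intro exI[of _ "[:[:0, c i:], [:c j:]:]"]) (simp add: mult.commute)
  qed
next
  case (const c)
  then show ?case
    by (intro exI[of _ "[:[:c:]:]"]) simp
next
  case (add f g)
  then obtain P Q where "\<forall>v. f v = bieval P (v $ i) (v $ j)" "\<forall>v. g v = bieval Q (v $ i) (v $ j)"
    by blast
  then show ?case
    by (intro exI[of _ "P + Q"]) simp
next
  case (mult f g)
  then obtain P Q where "\<forall>v. f v = bieval P (v $ i) (v $ j)" "\<forall>v. g v = bieval Q (v $ i) (v $ j)"
    by blast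
  then show ?case
    by (intro exI[of _ "P * Q"]) simp
qed

text \<open>The space is split by the sign of \<open>v $ i\<close>. The negative side is the
  reflection of the positive side for the polynomial \<open>p (- v)\<close>, and for
  \<open>v $ i = 0\<close> the condition is a one-variable one in \<open>v $ j\<close>.\<close>

lemma semigroup_algebra_polynomial_sign:
  fixes p :: "real ^ 'n \<Rightarrow> real"
  assumes UNIV: "(UNIV :: 'n set) = {i, j}" and p: "real_polynomial_function p"
  shows "{v. R (sgn (p v))} \<in> semigroup_algebra"
proof -
  have positive: "{v. 0 < v $ i \<and> R (sgn (q v))} \<in> semigroup_algebra"
    if q: "real_polynomial_function q" for q :: "real ^ 'n \<Rightarrow> real"
  proof -
    obtain Q where "\<forall>v. q v = bieval Q (v $ i) (v $ j)"
      using real_polynomial_function_bieval[OF UNIV q] by blast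
    then show ?thesis
      using semigroup_algebra_positive_coord[of i R Q j] by simp
  qed
  have "real_polynomial_function (\<lambda>v. p (- v))"
    using real_polynomial_function_compose[OF polynomial_function_minus[OF polynomial_function_id] p]
    by (simp add: o_def)
  then have "uminus -` {v. 0 < v $ i \<and> R (sgn (p (- v)))} \<in> semigroup_algebra"
    by (intro semigroup_algebra_vimage_uminus positive)
  moreover have "uminus -` {v. 0 < v $ i \<and> R (sgn (p (- v)))} = {v. v $ i < 0 \<and> R (sgn (p v))}"
    by auto
  ultimately have negative: "{v. v $ i < 0 \<and> R (sgn (p v))} \<in> semigroup_algebra"
    by simp
  obtain P where P: "\<forall>v. p v = bieval P (v $ i) (v $ j)"
    using real_polynomial_function_bieval[OF UNIV p] by blast
  obtain r where r: "\<forall>y. bieval P 0 y = poly r y"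
    using bieval_fixed_abscissa by blast
  have "{v :: real ^ 'n. v $ i = 0} \<in> semigroup_algebra"
    by (rule semigroup_algebra_base) (simp add: additive_semigroup_def)
  then have "{v. v $ i = 0} \<inter> {v. R (sgn (poly r (v $ j)))} \<in> semigroup_algebra"
    using semigroup_algebra_univariate by (rule semigroup_algebra_Int)
  moreover have "{v. R (sgn (p v))} = {v. 0 < v $ i \<and> R (sgn (p v))} \<union>
      {v. v $ i < 0 \<and> R (sgn (p v))} \<union> ({v. v $ i = 0} \<inter> {v. R (sgn (poly r (v $ j)))})"
    using P r by (auto simp: less_le)
  ultimately show ?thesis
    using positive[OF p] negative by (simp only: semigroup_algebra_Un)
qed

theorem theorem8:
  fixes S :: "(real ^ 'n::finite) set"
  assumes "CARD('n) \<in> {1, 2}"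
    and "semialgebraic S"
  shows "S \<in> semigroup_algebra"
proof -
  have "\<exists>i j. (UNIV :: 'n set) = {i, j}"
    using assms(1) by (auto simp: card_1_singleton_iff card_2_iff)
  then obtain i j where "(UNIV :: 'n set) = {i, j}"
    by blast
  note sign = semigroup_algebra_polynomial_sign[OF this]
  \<comment> \<open>Each generator is a condition on \<open>sgn (p x)\<close>, obtained by a
    suitable choice of \<open>R\<close>.\<close>
  have "{x. p x = 0} \<in> semigroup_algebra" "{x. p x > 0} \<in> semigroup_algebra"
    "{x. p x \<ge> 0} \<in> semigroup_algebra" if "real_polynomial_function p" for p :: "real ^ 'n \<Rightarrow> real"
    using sign[OF that, of "\<lambda>s. s = 0"] sign[OF that, of "\<lambda>s. s > 0"] sign[OF that, of "\<lambda>s. s \<ge> 0"]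
    by (simp_all add: sgn_zero_iff)
  moreover have "algebra UNIV (semigroup_algebra :: (real ^ 'n) set set)"
    unfolding semigroup_algebra_def by (rule algebra_generated_algebra)
  ultimately have "generated_algebra
     ({{x. p x = 0} | p. real_polynomial_function p} \<union>
      {{x. p x > 0} | p. real_polynomial_function p} \<union>
      {{x. p x \<ge> 0} | p. real_polynomial_function p}) \<subseteq> (semigroup_algebra :: (real ^ 'n) set set)"
    by (intro generated_algebra_minimal) auto
  then show ?thesis
    using assms(2) unfolding semialgebraic_def by blast
qed

end
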